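(* Let $\xi(t)$ be the compound Poisson process $\xi(t)=\sum_{k\le\nu(t)}\xi_k$ with rate $\lambda>0$ and jump distribution $\mathrm{P}\{\xi_k<x\}=qF(x)I\{x\le 0\}+(1-pe^{-cx})I\{x>0\}$ (see context), and let $s>0$, $T>0$. Then for every $0<x<T$ $$Q^T(s,x)=q_+(s)e^{-\rho_+(s)x}\int_{x-T}^{0}e^{\rho_+(s)y}\,dP_-(s,y)\;\left[e^{-\rho_+(s)T}\int_{-\infty}^{-T}e^{c(T+y)}\,dP_-(s,y)+\int_{-T}^{0}e^{\rho_+(s)y}\,dP_-(s,y)\right]^{-1}.$$
   Context: Process. $\nu(t)$ is a Poisson process with rate $\lambda>0$, $\xi_k$ are i.i.d. and independent of $\nu$, and $\xi(t)=\sum_{k\le \nu(t)}\xi_k$, $\xi(0)=0$. Here $c>0$, $p,q>0$, $p+q=1$, and $F$ is the cumulative distribution function of a strictly negative random variable (so $F(0)=1$): with probability $p$ a jump is positive and exponential with parameter $c$; with probability $q$ it is negative with distribution $F$. The cumulant ($\mathrm{E}e^{i\alpha\xi(t)}=e^{t\psi(\alpha)}$) is $\psi(\alpha)=\lambda p\left(\frac{c}{c-i\alpha}-1\right)+\lambda q(\varphi(\alpha)-1)$, $\varphi(\alpha)=\int_{-\infty}^0e^{i\alpha x}dF(x)$. Extrema. $\theta_s$ is an exponential random variable independent of $\xi$ with $\mathrm{P}\{\theta_s>t\}=e^{-st}$, $s>0$. $\xi^+(t)=\sup_{0\le u\le t}\xi(u)$, $\xi^-(t)=\inf_{0\le u\le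 t}\xi(u)$. $P_-(s,\cdot)$ is the distribution of $\xi^-(\theta_s)$, a probability distribution on $(-\infty,0]$. $p_+(s)=\mathrm{P}\{\xi^+(\theta_s)=0\}$, $q_+(s)=1-p_+(s)$, and $\rho_+(s)=c\,p_+(s)$, which is the positive root $r$ of Lundberg's equation $\psi(-ir)=s$. Exit. For $0<x<T$, $\tau(x,T)=\inf\{t>0:\xi(t)\notin(x-T,x)\}$, $A_+(x)=\{\xi(\tau(x,T))\ge x\}$, and $Q^T(s,x)=\mathrm{E}\left[e^{-s\tau(x,T)},A_+(x)\right]$, where $\mathrm{E}[X,A]$ means $\mathrm{E}[X\,I_A]$. Convention: for $a<0$, $\int_{a}^{0}g(y)\,dP_-(s,y)=\mathrm{E}[g(\xi^-(\theta_s)),\,a<\xi^-(\theta_s)\le 0]$ (the atom at $0$ is included) and $\int_{-\infty}^{a}g(y)\,dP_-(s,y)=\mathrm{E}[g(\xi^-(\theta_s)),\,\xi^-(\theta_s)\le a]$. *)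

theory Defs
  imports "HOL-Probability.Probability"
begin

(* Library indep_var requires both random elements to have the same type; this is the same
   notion for random elements with values in spaces over different types. *)
definition indep_elements ::
  "'a measure \<Rightarrow> 'b measure \<Rightarrow> ('a \<Rightarrow> 'b) \<Rightarrow> 'c measure \<Rightarrow> ('a \<Rightarrow> 'c) \<Rightarrow> bool" where
  "indep_elements M MA A MB B \<longleftrightarrow>
     A \<in> measurable M MA \<and> B \<in> measurable M MB \<and>
     prob_space.indep_set M {A -` S \<inter> space M | S. S \<in> sets MA}
                            {B -` S \<inter> space M | S. S \<in> sets MB}"

(* A process with time set {0..}, as a random element of the product space over {0..}. *)
definition sample_path :: "(real \<Rightarrow> 'a \<Rightarrow> 'b) \<Rightarrow> 'a \<Rightarrow> real \<Rightarrow> 'b" where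
  "sample_path Z \<omega> = (\<lambda>t\<in>{0..}. Z t \<omega>)"

(* Every path is nondecreasing and right-continuous (for the discrete topology of nat).
   Because of monotonicity the truncated subtraction of the increments is exact.
   Independence of the increments along every infinite nondecreasing sequence of times is
   the same as along every finite one, since a sequence may be eventually constant. *)
definition poisson_process :: "'a measure \<Rightarrow> real \<Rightarrow> (real \<Rightarrow> 'a \<Rightarrow> nat) \<Rightarrow> bool" where
  "poisson_process M lam N \<longleftrightarrow>
     (\<forall>t\<ge>0. N t \<in> measurable M (count_space UNIV)) \<and>
     (\<forall>\<omega>\<in>space M. N 0 \<omega> = 0) \<and>
     (\<forall>\<omega>\<in>space M. mono_on {0..} (\<lambda>t. N t \<omega>)) \<and>
     (\<forall>\<omega>\<in>space M. \<forall>t\<ge>0. continuous (at_right t) (\<lambda>u. N u \<omega>)) \<and>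
     (\<forall>u :: nat \<Rightarrow> real. 0 \<le> u 0 \<longrightarrow> mono u \<longrightarrow>
        prob_space.indep_vars M (\<lambda>_. count_space UNIV)
          (\<lambda>i \<omega>. N (u (Suc i)) \<omega> - N (u i) \<omega>) UNIV) \<and>
     (\<forall>t u. 0 \<le> t \<longrightarrow> t < u \<longrightarrow>
        distr M (count_space UNIV) (\<lambda>\<omega>. N u \<omega> - N t \<omega>)
          = measure_pmf (poisson_pmf (lam * (u - t))))"

(* The distribution function is the left-continuous one, F x = P(Y < x); this is the
   convention under which F 0 = 1 expresses that Y is strictly negative. *)
definition negative_cdf :: "(real \<Rightarrow> real) \<Rightarrow> bool" where
  "negative_cdf F \<longleftrightarrow>
     (\<exists>D. real_distribution D \<and> measure D {..<0} = 1 \<and> (\<forall>x. F x = measure D {..<x}))"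

definition compound_process ::
  "(real \<Rightarrow> 'a \<Rightarrow> nat) \<Rightarrow> (nat \<Rightarrow> 'a \<Rightarrow> real) \<Rightarrow> real \<Rightarrow> 'a \<Rightarrow> real" where
  "compound_process N X t \<omega> = (\<Sum>k = 1..N t \<omega>. X k \<omega>)"

definition running_sup :: "(real \<Rightarrow> 'a \<Rightarrow> real) \<Rightarrow> real \<Rightarrow> 'a \<Rightarrow> real" where
  "running_sup \<xi> t \<omega> = (SUP u\<in>{0..t}. \<xi> u \<omega>)"

definition running_inf :: "(real \<Rightarrow> 'a \<Rightarrow> real) \<Rightarrow> real \<Rightarrow> 'a \<Rightarrow> real" where
  "running_inf \<xi> t \<omega> = (INF u\<in>{0..t}. \<xi> u \<omega>)"

definition P_minus :: "'a measure \<Rightarrow> (real \<Rightarrow> 'a \<Rightarrow> real) \<Rightarrow> ('a \<Rightarrow> real) \<Rightarrow> real measure" where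
  "P_minus M \<xi> \<theta> = distr M borel (\<lambda>\<omega>. running_inf \<xi> (\<theta> \<omega>) \<omega>)"

definition p_plus :: "'a measure \<Rightarrow> (real \<Rightarrow> 'a \<Rightarrow> real) \<Rightarrow> ('a \<Rightarrow> real) \<Rightarrow> real" where
  "p_plus M \<xi> \<theta> = \<P>(\<omega> in M. running_sup \<xi> (\<theta> \<omega>) \<omega> = 0)"

definition q_plus :: "'a measure \<Rightarrow> (real \<Rightarrow> 'a \<Rightarrow> real) \<Rightarrow> ('a \<Rightarrow> real) \<Rightarrow> real" where
  "q_plus M \<xi> \<theta> = 1 - p_plus M \<xi> \<theta>"

definition rho_plus :: "'a measure \<Rightarrow> real \<Rightarrow> (real \<Rightarrow> 'a \<Rightarrow> real) \<Rightarrow> ('a \<Rightarrow> real) \<Rightarrow> real" where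
  "rho_plus M c \<xi> \<theta> = c * p_plus M \<xi> \<theta>"

(* Extended-real valued, so that the infimum over the empty set is infinity. *)
definition exit_time :: "(real \<Rightarrow> 'a \<Rightarrow> real) \<Rightarrow> real \<Rightarrow> real \<Rightarrow> 'a \<Rightarrow> ereal" where
  "exit_time \<xi> x T \<omega> = Inf (ereal ` {t. 0 < t \<and> \<xi> t \<omega> \<notin> {x - T<..<x}})"

definition exits_above :: "(real \<Rightarrow> 'a \<Rightarrow> real) \<Rightarrow> real \<Rightarrow> real \<Rightarrow> 'a set" where
  "exits_above \<xi> x T =
     {\<omega>. exit_time \<xi> x T \<omega> < \<infinity> \<and> x \<le> \<xi> (real_of_ereal (exit_time \<xi> x T \<omega>)) \<omega>}"

definition Q_exit :: "'a measure \<Rightarrow> (real \<Rightarrow> 'a \<Rightarrow> real) \<Rightarrow> real \<Rightarrow> real \<Rightarrow> real \<Rightarrow> real" where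
  "Q_exit M \<xi> T s x =
     (LINT \<omega>|M. exp (- s * real_of_ereal (exit_time \<xi> x T \<omega>))
                * indicator (exits_above \<xi> x T) \<omega>)"

end

theory Submission
  imports Defs
begin

text \<open>Since the jumps arrive at rate \<open>lam\<close>, observing the process at an independent exponential time of
  rate \<open>s\<close>, or discounting by \<open>e\<^bsup>-s t\<^esup>\<close>, amounts to killing the walk of partial sums with probability
  \<open>1 - a\<close> before each step, where \<open>a = lam / (lam + s)\<close>. All three quantities \<open>Q_exit\<close>, \<open>P_minus\<close> and
  \<open>p_plus\<close> are thus generating functions \<open>\<Sum>n. a\<^sup>n P(first hit at n)\<close>, and such a function is the only
  bounded solution of \<open>g(y) = a E g(y + X)\<close> on the continuation set with given values elsewhere.

  With \<open>r\<close> the root of \<open>a E e\<^bsup>r X\<^esup> = 1\<close> in \<open>(0, c)\<close>, the function \<open>(1 - r/c) e\<^bsup>r y\<^esup>\<close> solves the equation for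
  hitting the positive half-line, so \<open>p_plus = r/c\<close>. The killed minimum \<open>I\<close> satisfies \<open>I = 0\<close> with
  probability \<open>1 - a\<close> and otherwise has the law of \<open>min 0 (X + I)\<close>. The overshoot of \<open>X + I\<close> over \<open>0\<close> is
  exponential, so testing this identity with \<open>e\<^bsup>r y\<^esup>\<close> restricted to \<open>y > w - T\<close> shows that
  \<open>e\<^bsup>-r w\<^esup> E(e\<^bsup>r I\<^esup>; I > w - T)\<close> with \<open>w = x - y\<close> solves the equation for the two-sided exit; its mean
  over an exponential overshoot above \<open>x\<close> is, up to \<open>q_plus\<close>, the bracket in the theorem.\<close>

section \<open>First hitting of a killed random walk\<close>

text \<open>The transition operator of the walk stopped outside \<open>D\<close>. Through its powers
  the equations can be solved for a bare step law; \<open>expectation_walk_step\<close> later makes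
  the link to an actual walk.\<close>

definition walk_step :: "real measure \<Rightarrow> real set \<Rightarrow> (real \<Rightarrow> real) \<Rightarrow> real \<Rightarrow> real" where
  "walk_step \<mu> D f y = indicator D y * (\<integral>z. f (y + z) \<partial>\<mu>)"

text \<open>The probability that the walk with step law \<open>\<mu>\<close> started at \<open>y\<close> is in \<open>D\<close> before step \<open>n\<close>
  and in \<open>C\<close> at step \<open>n\<close>; see \<open>prob_first_hit\<close>.\<close>

definition first_hit :: "real measure \<Rightarrow> real set \<Rightarrow> real set \<Rightarrow> nat \<Rightarrow> real \<Rightarrow> real" where
  "first_hit \<mu> C D n = (walk_step \<mu> D ^^ n) (indicator C)"

lemma first_hit_0: "first_hit \<mu> C D 0 y = indicator C y"
  by (simp add: first_hit_def)

lemma first_hit_Suc: "first_hit \<mu> C D (Suc n) y = indicator D y * (\<integral>z. first_hit \<mu> C D n (y + z) \<partial>\<mu>)"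
  by (simp add: first_hit_def walk_step_def)

context real_distribution
begin

lemma integrable_bounded:
  fixes f :: "real \<Rightarrow> real"
  assumes "f \<in> borel_measurable borel" and "\<And>x. \<bar>f x\<bar> \<le> B"
  shows "integrable M f"
  using assms by (intro integrable_const_bound[of _ B]) auto

lemma integral_bounded:
  fixes f :: "real \<Rightarrow> real"
  assumes "f \<in> borel_measurable borel" and "\<And>x. \<bar>f x\<bar> \<le> B"
  shows "\<bar>\<integral>x. f x \<partial>M\<bar> \<le> B"
proof -
  have "\<bar>\<integral>x. f x \<partial>M\<bar> \<le> (\<integral>x. \<bar>f x\<bar> \<partial>M)"
    using integral_norm_bound[of M f] by simp
  also have "\<dots> \<le> (\<integral>x. B \<partial>M)"
    using assms by (intro integral_mono integrable_abs integrable_bounded) auto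
  also have "\<dots> = B" using prob_space by simp
  finally show ?thesis .
qed

lemma measurable_shift_integral [measurable]:
  fixes f :: "real \<Rightarrow> real"
  assumes [measurable]: "f \<in> borel_measurable borel"
  shows "(\<lambda>y. \<integral>z. f (y + z) \<partial>M) \<in> borel_measurable borel"
  by (rule borel_measurable_lebesgue_integral) measurable

lemma walk_step_measurable [measurable]:
  assumes [measurable]: "f \<in> borel_measurable borel" "D \<in> sets borel"
  shows "walk_step M D f \<in> borel_measurable borel"
  unfolding walk_step_def[abs_def] by measurable

lemma walk_step_bounded:
  assumes "f \<in> borel_measurable borel" and "\<And>x. \<bar>f x\<bar> \<le> B"
  shows "\<bar>walk_step M D f y\<bar> \<le> B"
proof -
  have "\<bar>\<integral>z. f (y + z) \<partial>M\<bar> \<le> B"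
    using assms by (intro integral_bounded) auto
  moreover have "0 \<le> B" using assms(2)[of 0] by linarith
  ultimately show ?thesis
    by (auto simp: walk_step_def abs_mult split: split_indicator)
qed

lemma walk_step_nonneg: "(\<And>y. 0 \<le> f y) \<Longrightarrow> 0 \<le> walk_step M D f y"
  by (auto simp: walk_step_def intro!: mult_nonneg_nonneg integral_nonneg_AE)

lemma first_hit_measurable [measurable]:
  assumes [measurable]: "C \<in> sets borel" "D \<in> sets borel"
  shows "first_hit M C D n \<in> borel_measurable borel"
proof (induction n)
  case 0 show ?case by (simp add: first_hit_def)
next
  case (Suc n)
  then have [measurable]: "(walk_step M D ^^ n) (indicator C) \<in> borel_measurable borel"
    by (simp add: first_hit_def)
  show ?case by (simp add: first_hit_def)
qed

lemma first_hit_bounds: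
  assumes C: "C \<in> sets borel" and D: "D \<in> sets borel"
  shows "0 \<le> first_hit M C D n y" and "first_hit M C D n y \<le> 1"
proof -
  have "(\<forall>y. 0 \<le> first_hit M C D n y) \<and> (\<forall>y. \<bar>first_hit M C D n y\<bar> \<le> 1)"
  proof (induction n)
    case 0 show ?case by (auto simp: first_hit_def split: split_indicator)
  next
    case (Suc n)
    have "first_hit M C D (Suc n) = walk_step M D (first_hit M C D n)"
      by (simp add: first_hit_def)
    moreover have "0 \<le> walk_step M D (first_hit M C D n) y" for y
      using Suc.IH by (intro walk_step_nonneg) auto
    moreover have "\<bar>walk_step M D (first_hit M C D n) y\<bar> \<le> 1" for y
      using Suc.IH by (intro walk_step_bounded first_hit_measurable C D) auto
    ultimately show ?case by metis
  qed
  then show "0 \<le> first_hit M C D n y" "first_hit M C D n y \<le> 1"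
    by (simp, metis abs_le_D1)
qed

lemma summable_first_hit:
  assumes "C \<in> sets borel" "D \<in> sets borel" "0 \<le> a" "a < 1"
  shows "summable (\<lambda>n. a ^ n * first_hit M C D n y)"
  using assms first_hit_bounds[of C D]
  by (intro summable_comparison_test'[OF summable_geometric[of a], of 0])
     (auto simp: abs_mult intro!: mult_left_le)

text \<open>The difference of two solutions is a fixed point of a contraction by the factor \<open>a\<close>.\<close>

lemma first_hit_generating_unique:
  fixes a K B :: real
  assumes [measurable]: "C \<in> sets borel" "D \<in> sets borel" "g \<in> borel_measurable borel"
    and a: "0 \<le> a" "a < 1"
    and disj: "C \<inter> D = {}"
    and bound: "\<And>y. \<bar>g y\<bar> \<le> B"
    and gC: "\<And>y. y \<in> C \<Longrightarrow> g y = K"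
    and g0: "\<And>y. y \<notin> C \<Longrightarrow> y \<notin> D \<Longrightarrow> g y = 0"
    and gD: "\<And>y. y \<in> D \<Longrightarrow> g y = a * (\<integral>z. g (y + z) \<partial>M)"
  shows "K * (\<Sum>n. a ^ n * first_hit M C D n y) = g y"
proof -
  let ?h = "first_hit M C D"
  have B: "0 \<le> B" using bound[of 0] by linarith
  have int_h: "integrable M (\<lambda>z. ?h k (y + z))" for k y
    using first_hit_bounds[of C D k] by (intro integrable_bounded[of _ 1]) auto
  have int_g: "integrable M (\<lambda>z. g (y + z))" for y
    using bound by (intro integrable_bounded[of _ B]) auto
  have main: "\<bar>g y - K * (\<Sum>k<n. a ^ k * ?h k y)\<bar> \<le> a ^ n * B" for n y
  proof (induction n arbitrary: y)
    case 0 then show ?case using bound by simp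
  next
    case (Suc n)
    \<comment> \<open>Splitting off the term \<open>k = 0\<close> and pulling one step out of the
      others expresses the partial sum at \<open>y\<close> through the shorter one at
      \<open>y + z\<close>. On \<open>D\<close> this is the recursion that \<open>g\<close> obeys,
      so each round multiplies the error by \<open>a\<close>.\<close>
    have split: "(\<Sum>k<Suc n. a ^ k * ?h k y)
        = indicator C y + indicator D y * (a * (\<integral>z. (\<Sum>k<n. a ^ k * ?h k (y + z)) \<partial>M))"
      unfolding sum.lessThan_Suc_shift
      by (simp add: first_hit_0 first_hit_Suc int_h sum_distrib_left mult_ac)
    consider "y \<in> C" "y \<notin> D" | "y \<in> D" "y \<notin> C" | "y \<notin> C" "y \<notin> D" using disj by blast
    then show ?case
    proof cases
      case 1 then show ?thesis using split gC a B by simp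
    next
      case 3 then show ?thesis using split g0 a B by simp
    next
      case 2
      have "g y - K * (\<Sum>k<Suc n. a ^ k * ?h k y)
          = a * (\<integral>z. g (y + z) - K * (\<Sum>k<n. a ^ k * ?h k (y + z)) \<partial>M)"
      proof -
        have "(\<integral>z. g (y + z) - K * (\<Sum>k<n. a ^ k * ?h k (y + z)) \<partial>M)
            = (\<integral>z. g (y + z) \<partial>M) - K * (\<integral>z. (\<Sum>k<n. a ^ k * ?h k (y + z)) \<partial>M)"
          using int_g int_h by simp
        then show ?thesis using 2 split gD by (simp add: right_diff_distrib)
      qed
      also have "\<bar>\<dots>\<bar> \<le> a * (a ^ n * B)"
        unfolding abs_mult using a Suc.IH
        by (intro mult_mono integral_bounded) auto
      finally show ?thesis by (simp add: mult_ac)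
    qed
  qed
  have lim: "(\<lambda>n. g y - K * (\<Sum>k<n. a ^ k * ?h k y))
      \<longlonglongrightarrow> g y - K * (\<Sum>k. a ^ k * ?h k y)"
    using a by (intro tendsto_intros summable_LIMSEQ summable_first_hit) auto
  have "(\<lambda>n. a ^ n * B) \<longlonglongrightarrow> 0"
    using a by (intro tendsto_mult_left_zero LIMSEQ_realpow_zero) auto
  then have "(\<lambda>n. g y - K * (\<Sum>k<n. a ^ k * ?h k y)) \<longlonglongrightarrow> 0"
    by (rule Lim_null_comparison[rotated]) (use main in auto)
  from LIMSEQ_unique[OF lim this] show ?thesis by simp
qed

end

section \<open>Exponential upper tails and the Lundberg root\<close>

lemma emeasure_exponential_gt:
  assumes "0 < l" "0 \<le> z"
  shows "emeasure (density lborel (exponential_density l)) {z<..} = ennreal (exp (- l * z))"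
proof -
  interpret E: prob_space "density lborel (exponential_density l)"
    by (rule prob_space_exponential_density[OF assms(1)])
  have "E.prob {x \<in> space (density lborel (exponential_density l)). z < x} = exp (- z * l)"
    using assms
    by (intro E.exponential_distributedD_gt[where X = "\<lambda>x. x"]) (auto simp: distributed_def distr_id2)
  then show ?thesis
    by (simp add: E.emeasure_eq_measure greaterThan_def mult.commute)
qed

text \<open>\<open>a\<close> is the probability of surviving a step. Only the positive part of the
  step law is specified, by closed tails because the jump law is given through the probabilities of
  \<open>X < y\<close>; on the nonpositive reals the law is arbitrary.\<close>

locale killed_walk = real_distribution M for M :: "real measure" +
  fixes a p c :: real
  assumes a: "0 < a" "a < 1" and p: "0 < p" "p < 1" and c: "0 < c"
    and tail_ge: "\<And>y. 0 < y \<Longrightarrow> measure M {y..} = p * exp (- c * y)"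
begin

text \<open>The closed half-lines from \<open>y + 1 / Suc n\<close> increase to the open one. The
  case \<open>y = 0\<close>, absent from \<open>tail_ge\<close>, identifies \<open>p\<close> as the
  mass of the positive reals.\<close>

lemma tail_gt: assumes "0 \<le> y" shows "measure M {y<..} = p * exp (- c * y)"
proof -
  have "(\<lambda>n. measure M {y + 1 / Suc n..}) \<longlonglongrightarrow> measure M (\<Union>n. {y + 1 / real (Suc n)..})"
    by (intro finite_Lim_measure_incseq) (auto simp: incseq_def frac_le intro: order_trans[rotated])
  moreover have "(\<Union>n. {y + 1 / real (Suc n)..}) = {y<..}"
  proof (intro equalityI subsetI)
    fix z assume "z \<in> {y<..}"
    then obtain n where "inverse (real (Suc n)) < z - y" using reals_Archimedean[of "z - y"] by auto
    then show "z \<in> (\<Union>n. {y + 1 / real (Suc n)..})" by (auto simp: inverse_eq_divide intro!: exI[of _ n])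
  qed (auto intro: less_le_trans[rotated])
  moreover have "(\<lambda>n. p * exp (- c * (y + 1 / Suc n))) \<longlonglongrightarrow> p * exp (- c * (y + 0))"
    by (intro tendsto_intros LIMSEQ_Suc[OF lim_1_over_n])
  moreover have "measure M {y + 1 / real (Suc n)..} = p * exp (- c * (y + 1 / Suc n))" for n
    by (rule tail_ge) (use assms in \<open>auto intro: add_nonneg_pos\<close>)
  ultimately show ?thesis using LIMSEQ_unique by fastforce
qed

text \<open>Closed and open tails at a positive level have equal mass, so there is no atom. This
  disposes of steps that land exactly on the upper barrier.\<close>

lemma AE_neq: assumes "0 < y" shows "AE x in M. x \<noteq> y"
proof -
  have "{y} = {y..} - {y<..}" by auto
  moreover have "measure M ({y..} - {y<..}) = measure M {y..} - measure M {y<..}"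
    by (rule finite_measure_Diff) auto
  ultimately have "emeasure M {y} = 0"
    using tail_ge[of y] tail_gt[of y] assms by (simp add: emeasure_eq_measure)
  then show ?thesis by (intro AE_I[of _ _ "{y}"]) auto
qed

text \<open>Both tails are \<open>exp (- c * y)\<close> for \<open>y \<ge> 0\<close> and
  \<open>1\<close> for \<open>y < 0\<close>, and the masses of open half-lines determine the
  law.\<close>

lemma positive_part_exponential:
  "uniform_measure M {0<..} = density lborel (exponential_density c)"
proof -
  have m0: "measure M {0<..} = p" using tail_gt[of 0] by simp
  interpret U: prob_space "uniform_measure M {0<..}"
    by (rule prob_space_uniform_measure) (use m0 p in \<open>auto simp: emeasure_eq_measure\<close>)
  interpret E: prob_space "density lborel (exponential_density c)"
    by (rule prob_space_exponential_density[OF c])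
  show ?thesis
  proof (rule measure_eqI_lessThan)
    fix y :: real
    note gt = emeasure_exponential_gt[OF c]
    show "emeasure (uniform_measure M {0<..}) {y<..} = emeasure (density lborel (exponential_density c)) {y<..}"
    proof (cases "0 \<le> y")
      case True
      then have "{0<..} \<inter> {y<..} = {y<..}" by auto
      then show ?thesis using gt[OF True] tail_gt[OF True] m0 p
        by (simp add: emeasure_eq_measure divide_ennreal)
    next
      case False
      have "{0<..} \<inter> {y<..} = {0<..}" using False by auto
      then have 1: "emeasure (uniform_measure M {0<..}) {y<..} = 1"
        using m0 p by (simp add: emeasure_eq_measure divide_ennreal)
      have "1 = emeasure (density lborel (exponential_density c)) {0<..}" using gt[of 0] by simp
      also have "\<dots> \<le> emeasure (density lborel (exponential_density c)) {y<..}"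
        using False by (intro emeasure_mono) auto
      finally show ?thesis using 1 E.emeasure_le_1 by (intro antisym) auto
    qed
  qed (auto simp: U.emeasure_eq_measure)
qed

text \<open>After passing to the exponential density, the factor \<open>exp (b * x)\<close> turns
  rate \<open>c\<close> into rate \<open>c - b\<close> at the cost of the constant
  \<open>c / (c - b)\<close>; what is left is an exponential tail.\<close>

lemma
  assumes "b < c" "0 \<le> z"
  shows integrable_exp_gt: "integrable M (\<lambda>x. indicator {z<..} x * exp (b * x))"
    and integral_exp_gt:
      "(\<integral>x. indicator {z<..} x * exp (b * x) \<partial>M) = p * c / (c - b) * exp (- (c - b) * z)"
proof -
  have m0: "emeasure M {0<..} = ennreal p" using tail_gt[of 0] by (simp add: emeasure_eq_measure)
  have eq: "ennreal (indicator {z<..} x * exp (b * x)) * indicator {0<..} x = ennreal (indicator {z<..} x * exp (b * x))" for x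
    using assms by (auto split: split_indicator)
  have "(\<integral>\<^sup>+x. ennreal (indicator {z<..} x * exp (b * x)) \<partial>M)
      = ennreal p * (\<integral>\<^sup>+x. ennreal (indicator {z<..} x * exp (b * x)) \<partial>uniform_measure M {0<..})"
    using p by (subst nn_integral_uniform_measure)
       (auto simp: m0 eq ennreal_times_divide mult_divide_eq_ennreal mult.commute[of "ennreal p"])
  also have "(\<integral>\<^sup>+x. ennreal (indicator {z<..} x * exp (b * x)) \<partial>uniform_measure M {0<..})
      = (\<integral>\<^sup>+x. ennreal (exponential_density c x) * ennreal (indicator {z<..} x * exp (b * x)) \<partial>lborel)"
    unfolding positive_part_exponential by (subst nn_integral_density) auto
  also have "\<dots> = (\<integral>\<^sup>+x. ennreal (c / (c - b)) * (ennreal (exponential_density (c - b) x) * indicator {z<..} x) \<partial>lborel)"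
  proof (intro nn_integral_cong)
    fix x
    have "exponential_density c x * exp (b * x) = c / (c - b) * exponential_density (c - b) x"
      using assms by (simp add: exponential_density_def mult_exp_exp mult.assoc) (simp add: algebra_simps)
    then show "ennreal (exponential_density c x) * ennreal (indicator {z<..} x * exp (b * x))
        = ennreal (c / (c - b)) * (ennreal (exponential_density (c - b) x) * indicator {z<..} x)"
      using assms c by (auto simp: ennreal_mult[symmetric] split: split_indicator)
  qed
  also have "\<dots> = ennreal (c / (c - b)) * emeasure (density lborel (exponential_density (c - b))) {z<..}"
    by (subst nn_integral_cmult) (auto simp: emeasure_density)
  also have "emeasure (density lborel (exponential_density (c - b))) {z<..} = ennreal (exp (- (c - b) * z))"
    by (rule emeasure_exponential_gt) (use assms in auto)
  finally have nn: "(\<integral>\<^sup>+x. ennreal (indicator {z<..} x * exp (b * x)) \<partial>M) = ennreal (p * c / (c - b) * exp (- (c - b) * z))"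
    using assms p c by (simp add: ennreal_mult[symmetric] mult.assoc)
  then have hb: "has_bochner_integral M (\<lambda>x. indicator {z<..} x * exp (b * x)) (p * c / (c - b) * exp (- (c - b) * z))"
    using assms p c by (intro has_bochner_integral_nn_integral) auto
  then show "integrable M (\<lambda>x. indicator {z<..} x * exp (b * x))"
    "(\<integral>x. indicator {z<..} x * exp (b * x) \<partial>M) = p * c / (c - b) * exp (- (c - b) * z)"
    by (auto simp: has_bochner_integral_iff)
qed

lemma integrable_exp: assumes "0 \<le> b" "b < c" shows "integrable M (\<lambda>x. exp (b * x))"
proof -
  have "integrable M (\<lambda>x. indicator {..0} x * exp (b * x))"
    using assms by (intro integrable_bounded[of _ 1]) (auto split: split_indicator simp: mult_nonneg_nonpos)
  from Bochner_Integration.integrable_add[OF this integrable_exp_gt[OF assms(2) order_refl]] show ?thesis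
    by (rule Bochner_Integration.integrable_cong[THEN iffD1, rotated -1])
       (auto split: split_indicator)
qed

text \<open>The root is that of \<open>r \<mapsto> (c - r) (1 - a E e\<^bsup>r X\<^esup>)\<close>, which extends continuously to
  the pole \<open>r = c\<close>.\<close>

lemma lundberg_root:
  obtains r where "0 < r" "r < c" "a * (\<integral>x. exp (r * x) \<partial>M) = 1"
proof -
  define \<phi> where "\<phi> r = (\<integral>x. indicator {..0} x * exp (r * x) \<partial>M)" for r
  have intn: "integrable M (\<lambda>x. indicator {..0} x * exp (r * x))" if "0 \<le> r" for r
    using that by (intro integrable_bounded[of _ 1]) (auto split: split_indicator simp: mult_nonneg_nonpos)
  have split: "(\<integral>x. exp (r * x) \<partial>M) = p * c / (c - r) + \<phi> r" if "0 \<le> r" "r < c" for r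
  proof -
    have "(\<integral>x. exp (r * x) \<partial>M)
        = (\<integral>x. indicator {0<..} x * exp (r * x) + indicator {..0} x * exp (r * x) \<partial>M)"
      by (intro Bochner_Integration.integral_cong) (auto split: split_indicator)
    then show ?thesis
      using that intn integrable_exp_gt[of r 0] integral_exp_gt[of r 0] by (simp add: \<phi>_def)
  qed
  \<comment> \<open>On the nonpositive reals the integrands are at most \<open>1\<close> for every
    nonnegative exponent, so dominated convergence gives continuity up to and including
    \<open>c\<close>.\<close>
  have cont: "continuous_on {0..c} \<phi>"
    unfolding continuous_on_sequentially
  proof safe
    fix u :: "nat \<Rightarrow> real" and l assume u: "\<forall>n. u n \<in> {0..c}" "l \<in> {0..c}" "u \<longlonglongrightarrow> l"
    show "(\<phi> \<circ> u) \<longlonglongrightarrow> \<phi> l"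
      unfolding \<phi>_def o_def
    proof (rule integral_dominated_convergence[where w = "\<lambda>_. 1"])
      show "AE x in M. (\<lambda>i. indicator {..0} x * exp (u i * x)) \<longlonglongrightarrow> indicator {..0} x * exp (l * x)"
        using u(3) by (intro AE_I2 tendsto_intros)
      show "AE x in M. norm (indicator {..0} x * exp (u i * x)) \<le> 1" for i
        using u(1) by (auto split: split_indicator simp: mult_nonneg_nonpos)
    qed auto
  qed
  define G where "G r = (c - r) - a * (p * c + (c - r) * \<phi> r)" for r
  have \<phi>0: "\<phi> 0 = 1 - p"
  proof -
    have "\<phi> 0 = measure M {..0}" by (simp add: \<phi>_def)
    also have "{..0} = space M - {0::real<..}" by auto
    finally show ?thesis using tail_gt[of 0] by (subst (asm) prob_compl) auto
  qed
  have "G c \<le> 0" using a p c by (simp add: G_def)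
  moreover have "0 \<le> G 0"
    using a c by (simp add: G_def \<phi>0 algebra_simps)
  moreover have "continuous_on {0..c} G"
    unfolding G_def by (intro continuous_intros cont)
  ultimately obtain r where r: "0 \<le> r" "r \<le> c" "G r = 0"
    using IVT2'[of G c 0 0] c by auto
  \<comment> \<open>The values are \<open>G c = - a * p * c\<close> and
    \<open>G 0 = c * (1 - a)\<close>; their strict signs keep the root away from both ends.\<close>
  have "G c < 0" "0 < G 0" using a p c by (auto simp: G_def \<phi>0 algebra_simps)
  then have r': "0 < r" "r < c" using r by (auto simp: less_le)
  have "(c - r) * (a * (\<integral>x. exp (r * x) \<partial>M)) = a * (p * c + (c - r) * \<phi> r)"
    using r' by (simp add: split distrib_left)
  also have "\<dots> = (c - r) * 1" using r by (simp add: G_def)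
  finally have "a * (\<integral>x. exp (r * x) \<partial>M) = 1"
    using r' by (subst (asm) mult_left_cancel) auto
  then show ?thesis using that r' by blast
qed

end

section \<open>The minimum of the killed walk and two-sided exit\<close>

context real_distribution
begin

text \<open>First-step analysis. Sum and integral may be exchanged because the terms are dominated
  by the geometric series in \<open>a\<close>.\<close>

lemma first_hit_generating_step:
  fixes a :: real
  assumes [measurable]: "C \<in> sets borel" "D \<in> sets borel" and a: "0 \<le> a" "a < 1"
  shows "(\<Sum>n. a ^ n * first_hit M C D n y)
    = indicator C y + indicator D y * (a * (\<integral>z. (\<Sum>n. a ^ n * first_hit M C D n (y + z)) \<partial>M))"
proof -
  let ?h = "first_hit M C D"
  note S = summable_first_hit[OF assms]
  have b: "0 \<le> ?h n u" "?h n u \<le> 1" for n u by (rule first_hit_bounds; measurable)+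
  have int: "integrable M (\<lambda>z. a ^ n * ?h n (y + z))" for n
    using b by (intro integrable_mult_right integrable_bounded[of _ 1]) auto
  have "summable (\<lambda>n. \<integral>z. norm (a ^ n * ?h n (y + z)) \<partial>M)"
  proof (rule summable_comparison_test'[OF summable_geometric[of a], of 0])
    fix n :: nat
    have "\<bar>\<integral>z. norm (a ^ n * ?h n (y + z)) \<partial>M\<bar> \<le> a ^ n"
      using a b by (intro integral_bounded) (auto simp: abs_mult intro!: mult_left_le)
    then show "norm (\<integral>z. norm (a ^ n * ?h n (y + z)) \<partial>M) \<le> a ^ n" by simp
  qed (use a in auto)
  then have "(\<integral>z. (\<Sum>n. a ^ n * ?h n (y + z)) \<partial>M) = (\<Sum>n. \<integral>z. a ^ n * ?h n (y + z) \<partial>M)"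
    using S a b by (intro integral_suminf int AE_I2) (auto simp: abs_mult)
  moreover have "(\<Sum>n. a ^ n * ?h n y) = ?h 0 y + (\<Sum>n. a ^ Suc n * ?h (Suc n) y)"
    using suminf_split_head[OF S, of y] by simp
  moreover have "(\<Sum>n. a ^ Suc n * ?h (Suc n) y)
      = (\<Sum>n. (a * indicator D y) * (\<integral>z. a ^ n * ?h n (y + z) \<partial>M))"
    by (simp add: first_hit_Suc mult_ac)
  moreover have "\<dots> = (a * indicator D y) * (\<Sum>n. \<integral>z. a ^ n * ?h n (y + z) \<partial>M)"
  proof (rule suminf_mult)
    show "summable (\<lambda>n. \<integral>z. a ^ n * ?h n (y + z) \<partial>M)"
      using \<open>summable (\<lambda>n. \<integral>z. norm (a ^ n * ?h n (y + z)) \<partial>M)\<close> a b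
      by (simp add: abs_mult)
  qed
  ultimately show ?thesis by (simp add: first_hit_0 mult_ac)
qed

text \<open>Spatial homogeneity: start and barrier move together. This reduces passage from any
  point to passage from \<open>0\<close>, the only start for which \<open>V\<close> is
  described.\<close>

lemma first_hit_translate:
  "first_hit M {..y + t} (- {..y + t}) n (z + t) = first_hit M {..y} (- {..y}) n z"
proof (induction n arbitrary: z)
  case 0 show ?case by (simp add: first_hit_0 indicator_def)
next
  case (Suc n)
  have "first_hit M {..y + t} (- {..y + t}) n (z + t + u) = first_hit M {..y} (- {..y}) n (z + u)" for u
    using Suc.IH[of "z + u"] by (simp add: add_ac)
  then show ?case by (simp add: first_hit_Suc indicator_def)
qed

end

text \<open>The assumptions say that \<open>V\<close> is the law of the minimum of the walk killed
  with probability \<open>1 - a\<close> before each step: the minimum is at most \<open>y\<close>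
  exactly if the walk enters \<open>{..y}\<close> before being killed. \<open>r\<close> is a root as
  found in \<open>lundberg_root\<close>.\<close>

locale killed_walk_minimum = killed_walk M a p c + V: real_distribution V
  for M a p c and V :: "real measure" +
  fixes r :: real
  assumes V_neg: "\<And>y. y < 0 \<Longrightarrow>
      measure V {..y} = (\<Sum>n. a ^ n * first_hit M {..y} (- {..y}) n 0)"
    and V_nonpos: "measure V {..0} = 1"
    and r: "0 < r" "r < c" "a * (\<integral>x. exp (r * x) \<partial>M) = 1"
begin

sublocale pair_prob_space M V ..

lemma AE_V_nonpos: "AE i in V. i \<le> 0"
  using V.prob_Collect_eq_1[of "\<lambda>i. i \<le> 0"] V_nonpos by (simp add: atMost_def)

lemma V_ge_0: "0 \<le> y \<Longrightarrow> measure V {..y} = 1"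
  using V.finite_measure_mono[of "{..0}" "{..y}"] V_nonpos V.prob_le_1[of "{..y}"] by auto

text \<open>Condition on the first step \<open>z\<close>. By translation the generating function
  started at \<open>z\<close> is the mass of \<open>{..y - z}\<close>; for \<open>z \<le> y\<close>
  the barrier is already passed and both sides are \<open>1\<close>.\<close>

lemma V_rec: assumes "y < 0" shows "measure V {..y} = a * (\<integral>z. measure V {..y - z} \<partial>M)"
proof -
  have *: "(\<Sum>n. a ^ n * first_hit M {..y} (- {..y}) n z) = measure V {..y - z}" for z
  proof (cases "z \<le> y")
    case True
    then show ?thesis
      using first_hit_generating_step[of "{..y}" "- {..y}" a z] a V_ge_0[of "y - z"] by simp
  next
    case False
    then show ?thesis using V_neg[of "y - z"] first_hit_translate[of "y - z" z _ 0] by simp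
  qed
  show ?thesis
    using first_hit_generating_step[of "{..y}" "- {..y}" a 0] a assms
    unfolding * by simp
qed

text \<open>With probability \<open>1 - a\<close> the walk dies at once; otherwise its minimum is
  \<open>0\<close> or the first step plus the minimum of the remaining walk, whichever is smaller.
  In terms of distribution functions this is \<open>V_rec\<close>, and a distribution function
  determines its law.\<close>

lemma minimum_fixed_point:
  fixes f :: "real \<Rightarrow> real"
  assumes [measurable]: "f \<in> borel_measurable borel" and bound: "\<And>y. \<bar>f y\<bar> \<le> B"
  shows "(\<integral>i. f i \<partial>V) = (1 - a) * f 0 + a * (\<integral>z. f (min 0 (fst z + snd z)) \<partial>(M \<Otimes>\<^sub>M V))"
proof -
  \<comment> \<open>A coin with success probability \<open>a\<close> realises the mixture as one
    random variable \<open>?g\<close>, whose law \<open>W\<close> is to be identified with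
    \<open>V\<close>.\<close>
  let ?P = "M \<Otimes>\<^sub>M V" and ?b = "measure_pmf (bernoulli_pmf a)"
  let ?g = "\<lambda>z. if fst z then min 0 (fst (snd z) + snd (snd z)) else (0::real)"
  interpret b: pair_prob_space ?b ?P ..
  have [measurable]: "?g \<in> borel_measurable (?b \<Otimes>\<^sub>M ?P)"
    by measurable
  define W where "W = distr (?b \<Otimes>\<^sub>M ?P) borel ?g"
  have W: "real_distribution W"
    unfolding W_def by (intro b.real_distribution_distr) measurable
  have intW: "(\<integral>i. h i \<partial>W) = (1 - a) * h 0 + a * (\<integral>z. h (min 0 (fst z + snd z)) \<partial>?P)"
    if [measurable]: "h \<in> borel_measurable borel" and h: "\<And>y. \<bar>h y\<bar> \<le> B'" for h :: "real \<Rightarrow> real" and B'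
  proof -
    have "(\<integral>i. h i \<partial>W) = (\<integral>z. h (?g z) \<partial>(?b \<Otimes>\<^sub>M ?P))"
      unfolding W_def by (subst integral_distr) auto
    also have "\<dots> = (\<integral>e. \<integral>z. h (?g (e, z)) \<partial>?P \<partial>?b)"
      using h by (intro b.integral_fst'[symmetric] b.P.integrable_const_bound[of _ B']) auto
    also have "\<dots> = (1 - a) * h 0 + a * (\<integral>z. h (min 0 (fst z + snd z)) \<partial>?P)"
      using a by (subst integral_bernoulli_pmf) (auto simp: P.prob_space)
    finally show ?thesis .
  qed
  have "V = W"
  proof (rule cdf_unique)
    show "cdf V = cdf W"
    proof
      fix y
      have cW: "measure W {..y} = (1 - a) * indicator {..y} 0
          + a * (\<integral>z. indicator {..y} (min 0 (fst z + snd z)) \<partial>?P)"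
      proof -
        interpret W: real_distribution W by fact
        have "measure W {..y} = (\<integral>i. indicator {..y} i \<partial>W)" by simp
        also note intW[of "indicator {..y}" 1]
        finally show ?thesis by (simp split: split_indicator)
      qed
      show "cdf V y = cdf W y"
      proof (cases "0 \<le> y")
        case True
        then have "indicator {..y} (min 0 (fst z + snd z)) = (1 :: real)" for z :: "real \<times> real" by auto
        with True show ?thesis using cW V_ge_0[of y] by (simp add: cdf_def P.prob_space)
      next
        case False
        have "(\<integral>z. (indicator {..y} (min 0 (fst z + snd z)) :: real) \<partial>?P)
            = (\<integral>x. \<integral>i. indicator {..y} (min 0 (x + i)) \<partial>V \<partial>M)"
        proof -
          have "integrable ?P (\<lambda>z. indicator {..y} (min 0 (fst z + snd z)) :: real)"
            by (rule P.integrable_const_bound[of _ 1]) auto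
          from integral_fst'[OF this] show ?thesis by simp
        qed
        \<comment> \<open>For negative \<open>y\<close> the cut-off at \<open>0\<close> does not
          affect whether the value is at most \<open>y\<close>.\<close>
        also have "\<dots> = (\<integral>x. measure V {..y - x} \<partial>M)"
        proof (intro Bochner_Integration.integral_cong refl)
          fix x
          have "(\<integral>i. (indicator {..y} (min 0 (x + i)) :: real) \<partial>V) = (\<integral>i. indicator {..y - x} i \<partial>V)"
            using False by (intro Bochner_Integration.integral_cong) (auto split: split_indicator)
          then show "(\<integral>i. indicator {..y} (min 0 (x + i)) \<partial>V) = measure V {..y - x}" by simp
        qed
        finally show ?thesis using False V_rec[of y] cW by (simp add: cdf_def)
      qed
    qed
  qed (use W V.real_distribution_axioms in auto)
  then show ?thesis using intW[OF assms] by simp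
qed

section \<open>Exponential moments of the killed minimum\<close>

definition shifted_exp_integral :: "real set \<Rightarrow> real" where
  "shifted_exp_integral S = (\<integral>z. indicator S (fst z + snd z) * exp (r * (fst z + snd z)) \<partial>(M \<Otimes>\<^sub>M V))"

lemma AE_P_snd_nonpos: "AE z in M \<Otimes>\<^sub>M V. snd z \<le> 0"
proof -
  have "AE x in M. AE i in V. snd (x, i) \<le> 0" using AE_V_nonpos by simp
  moreover have "{z \<in> space (M \<Otimes>\<^sub>M V). snd z \<le> 0} \<in> sets (M \<Otimes>\<^sub>M V)" by measurable
  ultimately show ?thesis by (intro AE_pair_measure) auto
qed

lemma integrable_exp_pair: "integrable (M \<Otimes>\<^sub>M V) (\<lambda>z. exp (r * (fst z + snd z)))"
proof (rule Bochner_Integration.integrable_bound)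
  show "integrable (M \<Otimes>\<^sub>M V) (\<lambda>z. exp (r * fst z))"
    using integrable_exp[of r] r
    by (intro Fubini_integrable) (auto simp: V.prob_space)
  show "AE z in M \<Otimes>\<^sub>M V. norm (exp (r * (fst z + snd z))) \<le> norm (exp (r * fst z))"
    using AE_P_snd_nonpos by eventually_elim (use r in auto)
qed simp

lemma integrable_indicator_exp_pair:
  assumes [measurable]: "S \<in> sets borel"
  shows "integrable (M \<Otimes>\<^sub>M V) (\<lambda>z. indicator S (fst z + snd z) * exp (r * (fst z + snd z)))"
  by (rule Bochner_Integration.integrable_bound[OF integrable_exp_pair])
     (auto split: split_indicator)

lemma V_exp_bounded: "0 \<le> exp (r * min 0 i)" "exp (r * min 0 i) \<le> 1"
  using r by (auto simp: mult_nonneg_nonpos min_def)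

text \<open>Given that the sum is positive, its excess over \<open>0\<close> is exponential with
  parameter \<open>c\<close> by lack of memory, and \<open>c / (c - r)\<close> is the corresponding
  moment. One Fubini formula is evaluated at \<open>b = r\<close> and at \<open>b = 0\<close>, where
  it becomes a probability.\<close>

lemma overshoot:
  "shifted_exp_integral {0<..} = c / (c - r) * measure (M \<Otimes>\<^sub>M V) {z. 0 < fst z + snd z}"
proof -
  have *: "(\<integral>z. indicator {0<..} (fst z + snd z) * exp (b * (fst z + snd z)) \<partial>(M \<Otimes>\<^sub>M V))
      = p * c / (c - b) * (\<integral>i. exp (c * i) \<partial>V)"
    if b: "0 \<le> b" "b < c"
      and int: "integrable (M \<Otimes>\<^sub>M V) (\<lambda>z. indicator {0<..} (fst z + snd z) * exp (b * (fst z + snd z)))" for b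
  proof -
    have "(\<integral>z. indicator {0<..} (fst z + snd z) * exp (b * (fst z + snd z)) \<partial>(M \<Otimes>\<^sub>M V))
      = (\<integral>i. \<integral>x. indicator {0<..} (x + i) * exp (b * (x + i)) \<partial>M \<partial>V)"
      using integral_snd[of "\<lambda>x i. indicator {0<..} (x + i) * exp (b * (x + i))"] int
      by (simp add: split_beta')
    also have "\<dots> = (\<integral>i. p * c / (c - b) * exp (c * i) \<partial>V)"
    proof (rule integral_cong_AE)
      show "AE i in V. (\<integral>x. indicator {0<..} (x + i) * exp (b * (x + i)) \<partial>M) = p * c / (c - b) * exp (c * i)"
        using AE_V_nonpos
      proof eventually_elim
        case (elim i)
        have "(\<integral>x. indicator {0<..} (x + i) * exp (b * (x + i)) \<partial>M)
            = (\<integral>x. exp (b * i) * (indicator {- i<..} x * exp (b * x)) \<partial>M)"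
          by (intro Bochner_Integration.integral_cong)
             (auto simp: distrib_left exp_add split: split_indicator)
        also have "\<dots> = exp (b * i) * (p * c / (c - b) * exp (- (c - b) * - i))"
          using integral_exp_gt[of b "- i"] b elim by simp
        also have "\<dots> = p * c / (c - b) * (exp (b * i) * exp (- (c - b) * - i))" by simp
        also have "exp (b * i) * exp (- (c - b) * - i) = exp (c * i)"
          by (simp add: mult_exp_exp algebra_simps)
        finally show ?case .
      qed
    qed auto
    finally show ?thesis by simp
  qed
  have "shifted_exp_integral {0<..} = p * c / (c - r) * (\<integral>i. exp (c * i) \<partial>V)"
    unfolding shifted_exp_integral_def using r by (intro * integrable_indicator_exp_pair) auto
  moreover have "measure (M \<Otimes>\<^sub>M V) {z. 0 < fst z + snd z} = p * (\<integral>i. exp (c * i) \<partial>V)"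
  proof -
    have "(\<integral>z. indicator {0<..} (fst z + snd z) * exp (0 * (fst z + snd z)) \<partial>(M \<Otimes>\<^sub>M V))
        = p * c / (c - 0) * (\<integral>i. exp (c * i) \<partial>V)"
      using c by (intro * P.integrable_const_bound[of _ 1]) auto
    moreover have "(\<integral>z. indicator {0<..} (fst z + snd z) * exp (0 * (fst z + snd z)) \<partial>(M \<Otimes>\<^sub>M V))
        = (\<integral>z. indicator {z. 0 < fst z + snd z} z \<partial>(M \<Otimes>\<^sub>M V))"
      by (intro Bochner_Integration.integral_cong) (auto split: split_indicator)
    moreover have "{z :: real \<times> real. 0 < fst z + snd z} \<inter> space (M \<Otimes>\<^sub>M V) = {z. 0 < fst z + snd z}"
      by (auto simp: space_pair_measure)
    ultimately show ?thesis using c by simp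
  qed
  ultimately show ?thesis by simp
qed

text \<open>This tests \<open>minimum_fixed_point\<close> with the exponential restricted to
  \<open>S\<close>. Where the sum is positive, the cut-off replaces the exponential by
  \<open>1\<close>. Since \<open>S\<close> contains \<open>{0..}\<close>, this correction, computed
  by \<open>overshoot\<close>, is the same for all such \<open>S\<close>.\<close>

lemma minimum_exp_integral_aux:
  assumes [measurable]: "S \<in> sets borel" and S: "{0..} \<subseteq> S"
  defines "\<pi> \<equiv> measure (M \<Otimes>\<^sub>M V) {z. 0 < fst z + snd z}"
  shows "(\<integral>i. indicator S i * exp (r * min 0 i) \<partial>V)
    = (1 - a) + a * \<pi> * (1 - c / (c - r)) + a * shifted_exp_integral S"
proof -
  have [simp]: "{z :: real \<times> real. 0 < fst z + snd z} \<inter> space (M \<Otimes>\<^sub>M V) = {z. 0 < fst z + snd z}"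
    by (auto simp: space_pair_measure)
  have "(\<integral>i. indicator S i * exp (r * min 0 i) \<partial>V) = (1 - a) * (indicator S 0 * exp (r * min 0 0))
      + a * (\<integral>z. indicator S (min 0 (fst z + snd z)) * exp (r * min 0 (min 0 (fst z + snd z))) \<partial>(M \<Otimes>\<^sub>M V))"
    using V_exp_bounded by (intro minimum_fixed_point[of _ 1]) (auto split: split_indicator)
  also have "(\<integral>z. indicator S (min 0 (fst z + snd z)) * exp (r * min 0 (min 0 (fst z + snd z))) \<partial>(M \<Otimes>\<^sub>M V))
      = (\<integral>z. indicator {z. 0 < fst z + snd z} z
          + (indicator S (fst z + snd z) * exp (r * (fst z + snd z))
             - indicator {0<..} (fst z + snd z) * exp (r * (fst z + snd z))) \<partial>(M \<Otimes>\<^sub>M V))"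
  proof (intro Bochner_Integration.integral_cong refl)
    fix z :: "real \<times> real"
    have "0 \<le> y \<Longrightarrow> y \<in> S" for y using S by auto
    then show "indicator S (min 0 (fst z + snd z)) * exp (r * min 0 (min 0 (fst z + snd z)))
      = indicator {z. 0 < fst z + snd z} z
          + (indicator S (fst z + snd z) * exp (r * (fst z + snd z))
             - indicator {0<..} (fst z + snd z) * exp (r * (fst z + snd z)))"
      by (cases "0 < fst z + snd z") (auto simp: min_def)
  qed
  also have "\<dots> = \<pi> + (shifted_exp_integral S - shifted_exp_integral {0<..})"
  proof -
    have "integrable (M \<Otimes>\<^sub>M V) (indicator {z. 0 < fst z + snd z} :: _ \<Rightarrow> real)"
      by (rule P.integrable_const_bound[of _ 1]) auto
    then show ?thesis
      unfolding shifted_exp_integral_def \<pi>_def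
      using integrable_indicator_exp_pair[of S] integrable_indicator_exp_pair[of "{0<..}"] by simp
  qed
  also have "(1 - a) * (indicator S 0 * exp (r * min 0 0)) = 1 - a" using S by auto
  finally show ?thesis unfolding overshoot \<pi>_def[symmetric] by (simp add: algebra_simps)
qed

text \<open>For \<open>S = UNIV\<close> independence factorises the right-hand side, and the root
  equation gives the identity directly. Hence the extra terms of
  \<open>minimum_exp_integral_aux\<close> add up to zero; as they do not depend on \<open>S\<close>,
  they vanish for every \<open>S\<close>.\<close>

lemma minimum_exp_integral:
  assumes [measurable]: "S \<in> sets borel" and S: "{0..} \<subseteq> S"
  shows "(\<integral>i. indicator S i * exp (r * min 0 i) \<partial>V) = a * shifted_exp_integral S"
proof -
  have "shifted_exp_integral UNIV = (\<integral>x. exp (r * x) \<partial>M) * (\<integral>i. exp (r * min 0 i) \<partial>V)"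
  proof -
    have "shifted_exp_integral UNIV = (\<integral>x. \<integral>i. exp (r * (x + i)) \<partial>V \<partial>M)"
      unfolding shifted_exp_integral_def
      using integral_fst'[of "\<lambda>z. exp (r * (fst z + snd z))"] integrable_exp_pair by simp
    also have "\<dots> = (\<integral>x. exp (r * x) * (\<integral>i. exp (r * min 0 i) \<partial>V) \<partial>M)"
    proof (intro Bochner_Integration.integral_cong refl)
      fix x
      have "(\<integral>i. exp (r * (x + i)) \<partial>V) = (\<integral>i. exp (r * x) * exp (r * min 0 i) \<partial>V)"
      proof (rule integral_cong_AE)
        show "AE i in V. exp (r * (x + i)) = exp (r * x) * exp (r * min 0 i)"
          using AE_V_nonpos by eventually_elim (simp add: distrib_left exp_add min_def)
      qed auto
      then show "(\<integral>i. exp (r * (x + i)) \<partial>V) = exp (r * x) * (\<integral>i. exp (r * min 0 i) \<partial>V)" by simp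
    qed
    finally show ?thesis by simp
  qed
  then have "a * shifted_exp_integral UNIV = (\<integral>i. exp (r * min 0 i) \<partial>V)"
    using r(3) by (simp add: mult.assoc[symmetric])
  moreover have "(\<integral>i. indicator UNIV i * exp (r * min 0 i) \<partial>V) = (\<integral>i. exp (r * min 0 i) \<partial>V)" by simp
  ultimately show ?thesis
    using minimum_exp_integral_aux[OF assms] minimum_exp_integral_aux[of UNIV] by simp
qed

text \<open>As \<open>V\<close> lives on the nonpositive reals, \<open>min 0 i\<close> is \<open>i\<close> almost everywhere; it keeps the
  integrands bounded.\<close>

definition exit_profile :: "real \<Rightarrow> real \<Rightarrow> real" where
  "exit_profile T w = exp (- r * w) * (\<integral>i. indicator {w - T<..} i * exp (r * min 0 i) \<partial>V)"

text \<open>The bracket of the theorem as a single integral. Times \<open>c / (c - r)\<close> it is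
  the mean of \<open>exit_profile\<close> over an exponential overshoot above the upper barrier, as
  computed inside \<open>exit_profile_eq\<close>.\<close>

definition exit_normalizer :: "real \<Rightarrow> real" where
  "exit_normalizer T = (\<integral>i. (if - T < i then exp (r * min 0 i) else exp (- r * T) * exp (c * (T + i))) \<partial>V)"

lemma exit_profile_measurable [measurable]: "exit_profile T \<in> borel_measurable borel"
proof -
  have "(\<lambda>w. \<integral>i. indicator {w - T<..} i * exp (r * min 0 i) \<partial>V) \<in> borel_measurable borel"
    by (rule V.borel_measurable_lebesgue_integral) (simp add: indicator_def)
  then show ?thesis unfolding exit_profile_def[abs_def] by measurable
qed

lemma integral_V_unit:
  assumes [measurable]: "f \<in> borel_measurable borel" and "\<And>i. 0 \<le> f i" "\<And>i. f i \<le> (1::real)"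
  shows "0 \<le> (\<integral>i. f i \<partial>V)" "(\<integral>i. f i \<partial>V) \<le> 1"
  using assms V.integral_bounded[of f 1] by (auto simp: abs_le_iff intro!: integral_nonneg_AE)

lemma exit_profile_bounds:
  shows "0 \<le> exit_profile T w" and "0 \<le> w \<Longrightarrow> exit_profile T w \<le> 1"
proof -
  have *: "0 \<le> (\<integral>i. indicator {w - T<..} i * exp (r * min 0 i) \<partial>V)"
    "(\<integral>i. indicator {w - T<..} i * exp (r * min 0 i) \<partial>V) \<le> 1"
    using V_exp_bounded by (intro integral_V_unit; auto split: split_indicator)+
  then show "0 \<le> exit_profile T w" by (simp add: exit_profile_def)
  assume "0 \<le> w"
  then have "exp (- r * w) \<le> 1" using r by simp
  then show "exit_profile T w \<le> 1" unfolding exit_profile_def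
    using * by (intro mult_le_one) auto
qed

text \<open>The boundary value after an exit below: \<open>V\<close> has no mass above
  \<open>w - T\<close> once this level is nonnegative.\<close>

lemma exit_profile_eq_0: "T \<le> w \<Longrightarrow> exit_profile T w = 0"
proof -
  assume "T \<le> w"
  have "AE i in V. indicator {w - T<..} i * exp (r * min 0 i) = (0 :: real)"
    using AE_V_nonpos by eventually_elim (use \<open>T \<le> w\<close> in \<open>auto split: split_indicator\<close>)
  then have "(\<integral>i. indicator {w - T<..} i * exp (r * min 0 i) \<partial>V) = (\<integral>i. 0 \<partial>V)"
    by (intro integral_cong_AE) auto
  then show ?thesis by (simp add: exit_profile_def)
qed

text \<open>A strictly positive integrand cannot have integral \<open>0\<close> under a probability
  measure. Positivity licenses the division in the exit formula.\<close>

lemma exit_normalizer_bounds: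
  assumes "0 < T"
  shows "0 < exit_normalizer T" "exit_normalizer T \<le> 1"
proof -
  let ?f = "\<lambda>i. if - T < i then exp (r * min 0 i) else exp (- r * T) * exp (c * (T + i))"
  have le: "?f i \<le> 1" for i
    using V_exp_bounded[of i] assms r c by (auto simp: mult_exp_exp[symmetric] mult_le_one mult_nonneg_nonpos)
  have pos: "0 < ?f i" for i by simp
  have b: "0 \<le> exit_normalizer T" "exit_normalizer T \<le> 1"
    unfolding exit_normalizer_def using le less_imp_le[OF pos] by (intro integral_V_unit; auto)+
  have "exit_normalizer T \<noteq> 0"
  proof
    assume "exit_normalizer T = 0"
    then have "AE i in V. ?f i = 0"
      unfolding exit_normalizer_def
      using le less_imp_le[OF pos]
      by (subst (asm) integral_nonneg_eq_0_iff_AE) (auto intro!: V.integrable_bounded[of _ 1])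
    then have "AE i in V. False" by eventually_elim (use pos in \<open>metis less_irrefl\<close>)
    then show False using V.AE_False by simp
  qed
  then show "0 < exit_normalizer T" "exit_normalizer T \<le> 1" using b by auto
qed

text \<open>\<open>minimum_exp_integral\<close> is applied to \<open>{w - T<..}\<close>, which
  contains \<open>{0..}\<close> because \<open>w < T\<close>. Integrating out the minimum first
  turns the integrand into \<open>exit_profile T (w - x)\<close>; the part with \<open>x > w\<close>
  is then replaced by a constant of the same total weight.\<close>

lemma exit_profile_eq:
  assumes "0 < T" "0 < w" "w < T"
  shows "exit_profile T w = a * (\<integral>x. (if x < w then exit_profile T (w - x)
      else c / (c - r) * exit_normalizer T) \<partial>M)"
proof -
  let ?e = "\<lambda>x i. indicator {w - T<..} (x + i) * exp (r * (x + i))"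
  have int: "integrable (M \<Otimes>\<^sub>M V) (\<lambda>(x, i). ?e x i)"
    using integrable_indicator_exp_pair[of "{w - T<..}"] by (simp add: split_beta')
  have atom: "AE x in M. x \<noteq> w" using AE_neq assms by simp
  have inner: "(\<integral>i. ?e x i \<partial>V) = exp (r * w) * exit_profile T (w - x)" for x
  proof -
    have "(\<integral>i. ?e x i \<partial>V) = (\<integral>i. exp (r * x) * (indicator {w - x - T<..} i * exp (r * min 0 i)) \<partial>V)"
    proof (rule integral_cong_AE)
      show "AE i in V. ?e x i = exp (r * x) * (indicator {w - x - T<..} i * exp (r * min 0 i))"
        using AE_V_nonpos
        by eventually_elim (auto simp: distrib_left exp_add min_def split: split_indicator)
    qed auto
    also have "\<dots> = (exp (r * w) * exp (- r * (w - x))) * (\<integral>i. indicator {w - x - T<..} i * exp (r * min 0 i) \<partial>V)"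
      by (simp add: mult_exp_exp algebra_simps)
    finally show ?thesis by (simp add: exit_profile_def mult.assoc)
  qed
  have int_inner: "integrable M (\<lambda>x. exit_profile T (w - x))"
  proof -
    have "integrable M (\<lambda>x. \<integral>i. ?e x i \<partial>V)" using integrable_fst[OF int] by simp
    then show ?thesis by (simp add: inner)
  qed
  \<comment> \<open>Here the profile has a negative argument, where it is merely a formula.
    Integrating over the step first, lack of memory splits the result into the tail at
    \<open>w\<close> times a constant.\<close>
  have above: "(\<integral>x. indicator {w<..} x * exit_profile T (w - x) \<partial>M)
      = p * exp (- c * w) * (c / (c - r) * exit_normalizer T)"
  proof -
    have "integrable (M \<Otimes>\<^sub>M V) (\<lambda>(x, i). indicator {w<..} x * ?e x i)"
      by (rule Bochner_Integration.integrable_bound[OF int]) (auto split: split_indicator)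
    then have "(\<integral>x. \<integral>i. indicator {w<..} x * ?e x i \<partial>V \<partial>M) = (\<integral>i. \<integral>x. indicator {w<..} x * ?e x i \<partial>M \<partial>V)"
      by (rule Fubini_integral[symmetric])
    also have "\<dots> = (\<integral>i. exp (r * w) * (p * exp (- c * w) * (c / (c - r) *
        (if - T < i then exp (r * min 0 i) else exp (- r * T) * exp (c * (T + i))))) \<partial>V)"
    proof (rule integral_cong_AE)
      show "AE i in V. (\<integral>x. indicator {w<..} x * ?e x i \<partial>M) = exp (r * w) * (p * exp (- c * w) * (c / (c - r) *
        (if - T < i then exp (r * min 0 i) else exp (- r * T) * exp (c * (T + i)))))"
        using AE_V_nonpos
      proof eventually_elim
        case (elim i)
        \<comment> \<open>The conditions \<open>w < x\<close> and \<open>w - T < x + i\<close>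
          together say \<open>?m < x\<close>; the two cases of the maximum yield the two branches of
          \<open>exit_normalizer\<close>.\<close>
        let ?m = "w + max 0 (- T - i)"
        have "(\<integral>x. indicator {w<..} x * ?e x i \<partial>M)
            = (\<integral>x. exp (r * i) * (indicator {?m<..} x * exp (r * x)) \<partial>M)"
          by (intro Bochner_Integration.integral_cong)
             (auto simp: distrib_left exp_add max_def split: split_indicator)
        also have "\<dots> = exp (r * i) * (p * c / (c - r) * exp (- (c - r) * ?m))"
          using integral_exp_gt[of r ?m] r assms by simp
        also have "\<dots> = p * (c / (c - r)) * (exp (r * i) * exp (- (c - r) * ?m))" by simp
        also have "exp (r * i) * exp (- (c - r) * ?m) = exp (r * w) * exp (- c * w) *
            (if - T < i then exp (r * min 0 i) else exp (- r * T) * exp (c * (T + i)))"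
          using elim by (auto simp: mult_exp_exp max_def min_def) (simp add: algebra_simps)+
        finally show ?case by (simp only: mult_ac)
      qed
    qed auto
    also have "\<dots> = exp (r * w) * (p * exp (- c * w) * (c / (c - r) * exit_normalizer T))"
      unfolding exit_normalizer_def by simp
    finally have "(\<integral>x. \<integral>i. indicator {w<..} x * ?e x i \<partial>V \<partial>M)
      = exp (r * w) * (p * exp (- c * w) * (c / (c - r) * exit_normalizer T))" .
    moreover have "(\<integral>x. \<integral>i. indicator {w<..} x * ?e x i \<partial>V \<partial>M)
        = exp (r * w) * (\<integral>x. indicator {w<..} x * exit_profile T (w - x) \<partial>M)"
      unfolding integral_mult_right_zero[symmetric]
      by (intro Bochner_Integration.integral_cong refl) (simp add: inner)
    ultimately show ?thesis by (metis exp_not_eq_zero mult_left_cancel)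
  qed
  have "exp (r * w) * exit_profile T w = (\<integral>i. indicator {w - T<..} i * exp (r * min 0 i) \<partial>V)"
    by (simp add: exit_profile_def mult.assoc[symmetric] mult_exp_exp)
  also have "\<dots> = a * shifted_exp_integral {w - T<..}"
    using assms by (intro minimum_exp_integral) auto
  also have "shifted_exp_integral {w - T<..} = (\<integral>x. \<integral>i. ?e x i \<partial>V \<partial>M)"
    unfolding shifted_exp_integral_def using integral_fst'[OF int] by (simp add: split_beta')
  also have "\<dots> = exp (r * w) * (\<integral>x. exit_profile T (w - x) \<partial>M)" by (simp add: inner)
  also have "(\<integral>x. exit_profile T (w - x) \<partial>M)
      = (\<integral>x. indicator {..<w} x * exit_profile T (w - x) + indicator {w<..} x * exit_profile T (w - x) \<partial>M)"
  proof (rule integral_cong_AE)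
    show "AE x in M. exit_profile T (w - x)
        = indicator {..<w} x * exit_profile T (w - x) + indicator {w<..} x * exit_profile T (w - x)"
      using atom by eventually_elim (auto split: split_indicator)
  qed auto
  also have "\<dots> = (\<integral>x. indicator {..<w} x * exit_profile T (w - x) \<partial>M)
      + (\<integral>x. indicator {w<..} x * exit_profile T (w - x) \<partial>M)"
    by (intro Bochner_Integration.integral_add; rule Bochner_Integration.integrable_bound[OF int_inner])
       (auto split: split_indicator)
  \<comment> \<open>Only the total contribution above \<open>w\<close> matters. The closed half-line
    carries the same mass as the open one, so the constant can be integrated over
    \<open>{w..}\<close>, which fits the target set of the exit problem.\<close>
  also have "(\<integral>x. indicator {w<..} x * exit_profile T (w - x) \<partial>M)
      = (\<integral>x. indicator {w..} x * (c / (c - r) * exit_normalizer T) \<partial>M)"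
    unfolding above using tail_ge[of w] assms by simp
  also have "(\<integral>x. indicator {..<w} x * exit_profile T (w - x) \<partial>M) + \<dots>
      = (\<integral>x. indicator {..<w} x * exit_profile T (w - x)
          + indicator {w..} x * (c / (c - r) * exit_normalizer T) \<partial>M)"
  proof (rule Bochner_Integration.integral_add[symmetric])
    show "integrable M (\<lambda>x. indicator {..<w} x * exit_profile T (w - x))"
      by (rule Bochner_Integration.integrable_bound[OF int_inner]) (auto split: split_indicator)
    show "integrable M (\<lambda>x. indicator {w..} x * (c / (c - r) * exit_normalizer T))"
      by (intro integrable_bounded[of _ "\<bar>c / (c - r) * exit_normalizer T\<bar>"]) (auto split: split_indicator)
  qed
  also have "\<dots> = (\<integral>x. (if x < w then exit_profile T (w - x) else c / (c - r) * exit_normalizer T) \<partial>M)"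
    by (intro Bochner_Integration.integral_cong) (auto split: split_indicator)
  finally show ?thesis by simp
qed

text \<open>The function equal to the profile below \<open>x\<close> and to its overshoot mean
  \<open>K\<close> from \<open>x\<close> on satisfies the hitting equation by
  \<open>exit_profile_eq\<close>. Uniqueness applies with boundary value \<open>K\<close>, and
  dividing by \<open>K\<close> gives the claim.\<close>

lemma first_hit_exit:
  assumes "0 < T" "0 < x" "x < T"
  shows "(\<Sum>n. a ^ n * first_hit M {x..} {x - T<..<x} n 0)
    = (c - r) / c * exit_profile T x / exit_normalizer T"
proof -
  define K where "K = c / (c - r) * exit_normalizer T"
  define g where "g y = (if y < x then exit_profile T (x - y) else K)" for y
  have K: "0 < K" using r c exit_normalizer_bounds(1)[of T] assms by (simp add: K_def)
  have "K * (\<Sum>n. a ^ n * first_hit M {x..} {x - T<..<x} n 0) = g 0"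
  proof (rule first_hit_generating_unique)
    show "g \<in> borel_measurable borel" unfolding g_def[abs_def] by measurable
    show "\<bar>g y\<bar> \<le> 1 + K" for y
      using K exit_profile_bounds[where T = T and w = "x - y"] by (auto simp: g_def)
    show "g y = 0" if "y \<notin> {x..}" "y \<notin> {x - T<..<x}" for y
      using that exit_profile_eq_0[of T "x - y"] by (auto simp: g_def)
    show "g y = a * (\<integral>z. g (y + z) \<partial>M)" if "y \<in> {x - T<..<x}" for y
    proof -
      have "(\<integral>z. g (y + z) \<partial>M) = (\<integral>z. (if z < x - y then exit_profile T (x - y - z) else K) \<partial>M)"
        by (intro Bochner_Integration.integral_cong) (auto simp: g_def algebra_simps)
      then show ?thesis using that exit_profile_eq[of T "x - y", folded K_def] assms by (simp add: g_def)
    qed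
  qed (use a in \<open>auto simp: g_def\<close>)
  then show ?thesis using K assms r c exit_normalizer_bounds(1)[of T] by (simp add: K_def g_def field_simps)
qed

end

section \<open>Passage into the positive half-line\<close>

context killed_walk
begin

text \<open>The factor \<open>1 - r / c\<close> is the reciprocal of the overshoot moment
  \<open>c / (c - r)\<close>. Hence, over steps that cross \<open>0\<close>, the scaled exponential
  and the constant \<open>1\<close> have the same mean, and the root equation does the rest.\<close>

lemma first_hit_positive:
  assumes r: "0 < r" "r < c" "a * (\<integral>x. exp (r * x) \<partial>M) = 1"
  shows "(\<Sum>n. a ^ n * first_hit M {0<..} (- {0<..}) n 0) = 1 - r / c"
proof -
  define g where "g y = (if 0 < y then 1 else (1 - r / c) * exp (r * y))" for y
  have "1 * (\<Sum>n. a ^ n * first_hit M {0<..} (- {0<..}) n 0) = g 0"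
  proof (rule first_hit_generating_unique)
    show "\<bar>g y\<bar> \<le> 1" for y
      using r c by (auto simp: g_def abs_mult mult_nonneg_nonpos intro!: mult_le_one)
    show "g \<in> borel_measurable borel" unfolding g_def[abs_def] by measurable
    show "g y = a * (\<integral>z. g (y + z) \<partial>M)" if "y \<in> - {0<..}" for y
    proof -
      have y: "y \<le> 0" using that by simp
      let ?i = "\<lambda>z. indicator {- y<..} z :: real"
      \<comment> \<open>The exponential is used for all steps and corrected on those that cross
        \<open>0\<close>.\<close>
      have "(\<integral>z. g (y + z) \<partial>M) = (\<integral>z. ?i z + ((1 - r / c) * exp (r * y) * exp (r * z)
          - (1 - r / c) * exp (r * y) * (?i z * exp (r * z))) \<partial>M)"
        by (intro Bochner_Integration.integral_cong)
           (auto simp: g_def distrib_left exp_add split: split_indicator)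
      also have "\<dots> = measure M {- y<..} + ((1 - r / c) * exp (r * y) * (\<integral>z. exp (r * z) \<partial>M)
          - (1 - r / c) * exp (r * y) * (\<integral>z. ?i z * exp (r * z) \<partial>M))"
        using integrable_exp[of r] integrable_exp_gt[of r "- y"] r y integrable_bounded[of ?i 1]
        by (subst Bochner_Integration.integral_add) auto
      also have "\<dots> = p * exp (c * y) + ((1 - r / c) * exp (r * y) * (1 / a)
          - (1 - r / c) * exp (r * y) * (p * c / (c - r) * exp ((c - r) * y)))"
      proof -
        have "(\<integral>z. exp (r * z) \<partial>M) = 1 / a" using r(3) a by (simp add: field_simps)
        moreover have "(\<integral>z. ?i z * exp (r * z) \<partial>M) = p * c / (c - r) * exp ((c - r) * y)"
          using integral_exp_gt[of r "- y"] r y by (simp add: algebra_simps)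
        moreover have "measure M {- y<..} = p * exp (c * y)"
          using tail_gt[of "- y"] y by simp
        ultimately show ?thesis by simp
      qed
      also have "(1 - r / c) * exp (r * y) * (p * c / (c - r) * exp ((c - r) * y))
          = p * (exp (r * y) * exp ((c - r) * y))"
        using r c by (simp add: field_simps)
      also have "exp (r * y) * exp ((c - r) * y) = exp (c * y)" by (simp add: mult_exp_exp algebra_simps)
      finally show ?thesis using y a by (simp add: g_def)
    qed
  qed (use a in \<open>auto simp: g_def\<close>)
  then show ?thesis by (simp add: g_def)
qed

end

section \<open>Walks of independent steps\<close>

context prob_space
begin

lemma indep_elements_prob:
  assumes "indep_elements M MA A MB B" "S \<in> sets MA" "T \<in> sets MB"
  shows "prob {\<omega> \<in> space M. A \<omega> \<in> S \<and> B \<omega> \<in> T}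
    = prob {\<omega> \<in> space M. A \<omega> \<in> S} * prob {\<omega> \<in> space M. B \<omega> \<in> T}"
proof -
  have "prob ((A -` S \<inter> space M) \<inter> (B -` T \<inter> space M)) = prob (A -` S \<inter> space M) * prob (B -` T \<inter> space M)"
    using assms by (intro indep_setD) (auto simp: indep_elements_def)
  moreover have "(A -` S \<inter> space M) \<inter> (B -` T \<inter> space M) = {\<omega> \<in> space M. A \<omega> \<in> S \<and> B \<omega> \<in> T}"
    "A -` S \<inter> space M = {\<omega> \<in> space M. A \<omega> \<in> S}" "B -` T \<inter> space M = {\<omega> \<in> space M. B \<omega> \<in> T}"
    by auto
  ultimately show ?thesis by simp
qed

text \<open>Independence gives agreement on rectangles, which determines a product of probability
  measures. Fubini then becomes available for the killing time and the path.\<close>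

lemma indep_elements_distr_pair:
  assumes ind: "indep_elements M MA A MB B"
  shows "distr M MA A \<Otimes>\<^sub>M distr M MB B = distr M (MA \<Otimes>\<^sub>M MB) (\<lambda>\<omega>. (A \<omega>, B \<omega>))"
proof -
  have [measurable]: "A \<in> measurable M MA" "B \<in> measurable M MB"
    using ind by (auto simp: indep_elements_def)
  interpret A: prob_space "distr M MA A" by (rule prob_space_distr) measurable
  interpret B: prob_space "distr M MB B" by (rule prob_space_distr) measurable
  show ?thesis
  proof (rule pair_measure_eqI)
    fix S T assume "S \<in> sets (distr M MA A)" "T \<in> sets (distr M MB B)"
    then have [measurable]: "S \<in> sets MA" "T \<in> sets MB" by auto
    have "emeasure (distr M (MA \<Otimes>\<^sub>M MB) (\<lambda>\<omega>. (A \<omega>, B \<omega>))) (S \<times> T)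
        = emeasure M {\<omega> \<in> space M. A \<omega> \<in> S \<and> B \<omega> \<in> T}"
      by (subst emeasure_distr) (auto intro!: arg_cong2[where f = emeasure])
    also have "\<dots> = emeasure M {\<omega> \<in> space M. A \<omega> \<in> S} * emeasure M {\<omega> \<in> space M. B \<omega> \<in> T}"
      using indep_elements_prob[OF ind, of S T] by (simp add: emeasure_eq_measure ennreal_mult'')
    also have "\<dots> = emeasure (distr M MA A) S * emeasure (distr M MB B) T"
      by (subst (1 2) emeasure_distr) (auto intro!: arg_cong2[where f = "(*)"] arg_cong2[where f = emeasure])
    finally show "emeasure (distr M MA A) S * emeasure (distr M MB B) T
        = emeasure (distr M (MA \<Otimes>\<^sub>M MB) (\<lambda>\<omega>. (A \<omega>, B \<omega>))) (S \<times> T)" ..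
  qed (auto intro: A.sigma_finite_measure_axioms B.sigma_finite_measure_axioms)
qed

end

definition partial_sum :: "(nat \<Rightarrow> 'a \<Rightarrow> real) \<Rightarrow> nat \<Rightarrow> 'a \<Rightarrow> real" where
  "partial_sum X n \<omega> = (\<Sum>k = 1..n. X k \<omega>)"

lemma partial_sum_0 [simp]: "partial_sum X 0 \<omega> = 0"
  by (simp add: partial_sum_def)

locale random_walk = prob_space M for M :: "'a measure" +
  fixes X :: "nat \<Rightarrow> 'a \<Rightarrow> real" and \<mu> :: "real measure"
  assumes indep: "indep_vars (\<lambda>_. borel) X {1..}"
    and law: "\<And>k. 1 \<le> k \<Longrightarrow> distr M borel (X k) = \<mu>"
begin

lemma X_measurable: "1 \<le> k \<Longrightarrow> X k \<in> borel_measurable M"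
  using indep by (auto simp: indep_vars_def)

sublocale mu: real_distribution \<mu>
  using law[of 1] X_measurable[of 1] by (metis order_refl real_distribution_distr)

lemma partial_sum_measurable [measurable]: "partial_sum X n \<in> borel_measurable M"
  unfolding partial_sum_def[abs_def] by (intro borel_measurable_sum X_measurable) auto

text \<open>The Markov property, by induction with \<open>f\<close> general: the last step is
  independent of the earlier ones, and integrating it out replaces \<open>f\<close> by
  \<open>walk_step \<mu> D f\<close>, which also absorbs the indicator at time
  \<open>n\<close>.\<close>

lemma expectation_walk_step:
  fixes f :: "real \<Rightarrow> real"
  assumes [measurable]: "D \<in> sets borel" "f \<in> borel_measurable borel" and B: "\<And>y. \<bar>f y\<bar> \<le> B"
  shows "(\<integral>\<omega>. (\<Prod>j<n. indicator D (partial_sum X j \<omega>)) * f (partial_sum X n \<omega>) \<partial>M)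
    = (walk_step \<mu> D ^^ n) f 0"
  using assms(2) B
proof (induction n arbitrary: f)
  case 0
  then show ?case by (simp add: prob_space)
next
  case (Suc n)
  note [measurable] = Suc.prems(1)
  let ?Y = "\<lambda>\<omega>. restrict (\<lambda>i. X i \<omega>) {1..n}" and ?Z = "\<lambda>\<omega>. restrict (\<lambda>i. X i \<omega>) {Suc n}"
  let ?MY = "PiM {1..n} (\<lambda>_. borel :: real measure)" and ?MZ = "PiM {Suc n} (\<lambda>_. borel :: real measure)"
  have iv: "indep_var ?MY ?Y ?MZ ?Z"
    by (rule indep_var_restrict[OF indep]) auto
  have [measurable]: "?Y \<in> measurable M ?MY" "?Z \<in> measurable M ?MZ"
    using indep_var_rv1[OF iv] indep_var_rv2[OF iv] by auto
  \<comment> \<open>The integrand as a function of two independent blocks, the first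
    \<open>n\<close> steps and step \<open>Suc n\<close>, so that their joint law
    factorises.\<close>
  define \<Phi> where "\<Phi> z = (\<Prod>j<Suc n. indicator D (\<Sum>k=1..j. fst z k)) * f ((\<Sum>k=1..n. fst z k) + snd z (Suc n))"
    for z :: "(nat \<Rightarrow> real) \<times> (nat \<Rightarrow> real)"
  have [measurable]: "(\<lambda>w. w k) \<in> borel_measurable ?MY" if "k \<in> {1..n}" for k
    using that by measurable
  have S: "(\<lambda>w. \<Sum>k=1..j. w k) \<in> borel_measurable ?MY" if "j \<le> n" for j
    using that by (intro borel_measurable_sum) auto
  have \<Phi>_meas [measurable]: "\<Phi> \<in> borel_measurable (?MY \<Otimes>\<^sub>M ?MZ)"
  proof -
    have "(\<lambda>z. \<Sum>k=1..j. fst z k) \<in> borel_measurable (?MY \<Otimes>\<^sub>M ?MZ)" if "j \<le> n" for j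
      using measurable_compose[OF measurable_fst S[OF that]] by simp
    then show ?thesis unfolding \<Phi>_def[abs_def]
      by (intro borel_measurable_times borel_measurable_prod
            measurable_compose[OF _ Suc.prems(1)] borel_measurable_add
            measurable_compose[OF _ borel_measurable_indicator[OF assms(1)]]) auto
  qed
  have ind_le: "\<bar>(\<Prod>j\<in>J. indicator D (u j)) :: real\<bar> \<le> 1" for J and u :: "nat \<Rightarrow> real"
    by (auto simp: abs_prod intro!: prod_le_1 split: split_indicator)
  have "\<bar>\<Phi> z\<bar> \<le> 1 * B" for z
    unfolding \<Phi>_def by (subst abs_mult, rule mult_mono[OF ind_le Suc.prems(2)]) auto
  then have \<Phi>_le: "\<bar>\<Phi> z\<bar> \<le> B" for z by simp
  have Y_sum: "(\<Sum>k=1..j. ?Y \<omega> k) = partial_sum X j \<omega>" if "j \<le> n" for j \<omega>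
    using that by (simp add: partial_sum_def)
  have \<Phi>_eq: "\<Phi> (?Y \<omega>, ?Z \<omega>') = (\<Prod>j<Suc n. indicator D (partial_sum X j \<omega>)) * f (partial_sum X n \<omega> + X (Suc n) \<omega>')"
    for \<omega> \<omega>'
    unfolding \<Phi>_def fst_conv snd_conv
    by (intro arg_cong2[where f = "(*)"] prod.cong arg_cong[where f = f] arg_cong2[where f = "(+)"])
       (auto simp: Y_sum partial_sum_def)
  interpret Y: prob_space "distr M ?MY ?Y" by (rule prob_space_distr) measurable
  interpret Z: prob_space "distr M ?MZ ?Z" by (rule prob_space_distr) measurable
  interpret YZ: pair_prob_space "distr M ?MY ?Y" "distr M ?MZ ?Z" ..
  have "(\<integral>\<omega>. (\<Prod>j<Suc n. indicator D (partial_sum X j \<omega>)) * f (partial_sum X (Suc n) \<omega>) \<partial>M)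
      = (\<integral>\<omega>. \<Phi> (?Y \<omega>, ?Z \<omega>) \<partial>M)"
    unfolding \<Phi>_eq by (simp add: partial_sum_def add.commute)
  also have "\<dots> = (\<integral>z. \<Phi> z \<partial>distr M (?MY \<Otimes>\<^sub>M ?MZ) (\<lambda>\<omega>. (?Y \<omega>, ?Z \<omega>)))"
    by (rule integral_distr[symmetric]) measurable
  also have "\<dots> = (\<integral>z. \<Phi> z \<partial>(distr M ?MY ?Y \<Otimes>\<^sub>M distr M ?MZ ?Z))"
    using iv by (simp add: indep_var_distribution_eq)
  also have "\<dots> = (\<integral>y. \<integral>z. \<Phi> (y, z) \<partial>distr M ?MZ ?Z \<partial>distr M ?MY ?Y)"
  proof (rule YZ.integral_fst'[symmetric], rule YZ.P.integrable_const_bound[of _ B])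
    show "\<Phi> \<in> borel_measurable (distr M ?MY ?Y \<Otimes>\<^sub>M distr M ?MZ ?Z)" by measurable
  qed (use \<Phi>_le in simp)
  also have "\<dots> = (\<integral>\<omega>. \<integral>\<omega>'. \<Phi> (?Y \<omega>, ?Z \<omega>') \<partial>M \<partial>M)"
  proof -
    have "(\<integral>z. \<Phi> (y, z) \<partial>distr M ?MZ ?Z) = (\<integral>\<omega>'. \<Phi> (y, ?Z \<omega>') \<partial>M)" if "y \<in> space ?MY" for y
      using that by (intro integral_distr) measurable
    moreover have "?Y \<omega> \<in> space ?MY" for \<omega> by (auto simp: space_PiM)
    moreover have "(\<integral>y. \<integral>z. \<Phi> (y, z) \<partial>distr M ?MZ ?Z \<partial>distr M ?MY ?Y)
        = (\<integral>\<omega>. \<integral>z. \<Phi> (?Y \<omega>, z) \<partial>distr M ?MZ ?Z \<partial>M)"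
      by (intro integral_distr Z.borel_measurable_lebesgue_integral) measurable
    ultimately show ?thesis by simp
  qed
  also have "\<dots> = (\<integral>\<omega>. (\<Prod>j<n. indicator D (partial_sum X j \<omega>)) * walk_step \<mu> D f (partial_sum X n \<omega>) \<partial>M)"
  proof (intro Bochner_Integration.integral_cong refl)
    fix \<omega>
    have "(\<integral>\<omega>'. f (partial_sum X n \<omega> + X (Suc n) \<omega>') \<partial>M) = (\<integral>z. f (partial_sum X n \<omega> + z) \<partial>\<mu>)"
      using X_measurable[of "Suc n"] by (subst law[of "Suc n", symmetric]) (auto simp: integral_distr)
    then show "(\<integral>\<omega>'. \<Phi> (?Y \<omega>, ?Z \<omega>') \<partial>M)
        = (\<Prod>j<n. indicator D (partial_sum X j \<omega>)) * walk_step \<mu> D f (partial_sum X n \<omega>)"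
      unfolding \<Phi>_eq by (simp add: walk_step_def mult_ac)
  qed
  also have "\<dots> = (walk_step \<mu> D ^^ n) (walk_step \<mu> D f) 0"
    using mu.walk_step_bounded[OF Suc.prems] by (intro Suc.IH) auto
  finally show ?case by (simp add: funpow_swap1)
qed

lemma prob_first_hit:
  assumes [measurable]: "C \<in> sets borel" "D \<in> sets borel"
  shows "prob {\<omega> \<in> space M. (\<forall>j<n. partial_sum X j \<omega> \<in> D) \<and> partial_sum X n \<omega> \<in> C} = first_hit \<mu> C D n 0"
proof -
  let ?E = "{\<omega> \<in> space M. (\<forall>j<n. partial_sum X j \<omega> \<in> D) \<and> partial_sum X n \<omega> \<in> C}"
  have "prob ?E = (\<integral>\<omega>. indicator ?E \<omega> \<partial>M)" by simp
  also have "\<dots> = (\<integral>\<omega>. (\<Prod>j<n. indicator D (partial_sum X j \<omega>)) * indicator C (partial_sum X n \<omega>) \<partial>M)"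
  proof (intro Bochner_Integration.integral_cong refl)
    fix \<omega> assume "\<omega> \<in> space M"
    have "(\<Prod>j<n. indicator D (partial_sum X j \<omega>)) = (if \<forall>j<n. partial_sum X j \<omega> \<in> D then 1 else 0 :: real)"
      by (induction n) (auto simp: less_Suc_eq)
    then show "indicator ?E \<omega> = (\<Prod>j<n. indicator D (partial_sum X j \<omega>)) * (indicator C (partial_sum X n \<omega>) :: real)"
      using \<open>\<omega> \<in> space M\<close> by (auto split: split_indicator)
  qed
  also have "\<dots> = first_hit \<mu> C D n 0"
    unfolding first_hit_def by (rule expectation_walk_step[of _ _ 1]) auto
  finally show ?thesis .
qed

end

section \<open>Poisson processes\<close>

text \<open>The complement has mass \<open>(1 + x) * exp (- x)\<close>, and
  \<open>1 - x \<le> exp (- x)\<close> bounds this below by \<open>1 - x\<^sup>2\<close>.\<close>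

lemma poisson_tail_2:
  assumes "0 < x" shows "measure (measure_pmf (poisson_pmf x)) {2..} \<le> x\<^sup>2"
proof -
  have "measure (measure_pmf (poisson_pmf x)) {2..} = 1 - measure (measure_pmf (poisson_pmf x)) {0, 1}"
  proof -
    have "{2..} = space (measure_pmf (poisson_pmf x)) - {0, 1::nat}" by auto
    then show ?thesis using measure_pmf.prob_compl[of "{0, 1}" "poisson_pmf x"] by simp
  qed
  moreover have "measure (measure_pmf (poisson_pmf x)) {0, 1} = (1 + x) * exp (- x)"
    using assms by (subst measure_measure_pmf_finite) (auto simp: algebra_simps)
  moreover have "(1 + x) * (1 - x) \<le> (1 + x) * exp (- x)"
    using assms exp_ge_add_one_self[of "- x"] by (intro mult_left_mono) auto
  moreover have "(1 + x) * (1 - x) = 1 - x\<^sup>2" by (simp add: algebra_simps power2_eq_square)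
  ultimately show ?thesis by linarith
qed

text \<open>Truncated subtraction restricts only upward moves; a sequence that climbs by at most one
  cannot jump over \<open>n\<close>.\<close>

lemma discrete_ivt:
  fixes f :: "nat \<Rightarrow> nat"
  assumes "\<And>i. i < k \<Longrightarrow> f (Suc i) - f i \<le> 1" "f 0 \<le> n" "n \<le> f k"
  shows "\<exists>i\<le>k. f i = n"
  using assms
proof (induction k)
  case (Suc k)
  show ?case
  proof (cases "n \<le> f k")
    case True
    then show ?thesis using Suc by (metis le_SucI less_SucI)
  next
    case False
    then have "f (Suc k) = n" using Suc.prems(1)[of k] Suc.prems(3) by simp
    then show ?thesis by blast
  qed
qed auto

locale poisson_counting = prob_space M for M :: "'a measure" +
  fixes N :: "real \<Rightarrow> 'a \<Rightarrow> nat" and lam :: real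
  assumes poisson: "poisson_process M lam N" and lam: "0 < lam"
begin

lemma N_measurable: "0 \<le> t \<Longrightarrow> N t \<in> measurable M (count_space UNIV)"
  and N_0: "\<omega> \<in> space M \<Longrightarrow> N 0 \<omega> = 0"
  using poisson by (auto simp: poisson_process_def)

lemma N_mono: "\<omega> \<in> space M \<Longrightarrow> 0 \<le> t \<Longrightarrow> t \<le> u \<Longrightarrow> N t \<omega> \<le> N u \<omega>"
  using poisson by (auto simp: poisson_process_def mono_on_def)

lemma N_right_constant:
  assumes "\<omega> \<in> space M" "0 \<le> t"
  obtains e where "0 < e" "\<And>u. t \<le> u \<Longrightarrow> u < t + e \<Longrightarrow> N u \<omega> = N t \<omega>"
proof -
  have "continuous (at_right t) (\<lambda>u. N u \<omega>)"
    using assms poisson by (auto simp: poisson_process_def)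
  then have "eventually (\<lambda>u. N u \<omega> = N t \<omega>) (at_right t)"
    by (simp add: continuous_within tendsto_discrete)
  then obtain b where "t < b" "\<And>u. t < u \<Longrightarrow> u < b \<Longrightarrow> N u \<omega> = N t \<omega>"
    unfolding eventually_at_right_field by blast
  then show ?thesis using that[of "b - t"] by (metis add_diff_cancel_left' add_diff_eq diff_gt_0_iff_gt less_eq_real_def)
qed

lemma N_distr: assumes "0 < t" shows "distr M (count_space UNIV) (N t) = measure_pmf (poisson_pmf (lam * t))"
proof -
  have "distr M (count_space UNIV) (\<lambda>\<omega>. N t \<omega> - N 0 \<omega>) = measure_pmf (poisson_pmf (lam * (t - 0)))"
    using poisson assms by (auto simp: poisson_process_def)
  moreover have "distr M (count_space UNIV) (\<lambda>\<omega>. N t \<omega> - N 0 \<omega>) = distr M (count_space UNIV) (N t)"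
    by (intro distr_cong) (auto simp: N_0)
  ultimately show ?thesis by simp
qed

text \<open>A jump of size at least 2 before time \<open>T\<close> shows up on every mesh; the mesh of width \<open>1/m\<close>
  sees one with probability at most \<open>T m (lam/m)\<^sup>2\<close>.\<close>

lemma AE_mesh:
  "AE \<omega> in M. \<exists>m. \<forall>i<T * Suc m. N (real (Suc i) / Suc m) \<omega> - N (real i / Suc m) \<omega> \<le> 1"
proof -
  let ?d = "\<lambda>m i \<omega>. N (real (Suc i) / Suc m) \<omega> - N (real i / Suc m) \<omega>"
  have [measurable]: "N (real i / Suc m) \<in> measurable M (count_space UNIV)" for i m
    by (rule N_measurable) simp
  define G where "G m = {\<omega> \<in> space M. \<forall>i<T * Suc m. ?d m i \<omega> \<le> 1}" for m
  have [measurable]: "G m \<in> sets M" for m unfolding G_def by measurable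
  \<comment> \<open>The complement of the union lies in that of each single \<open>G m\<close>. The
    bound therefore holds for every mesh and can be sent to \<open>0\<close>.\<close>
  have bound: "prob (space M - (\<Union>m. G m)) \<le> T * lam\<^sup>2 / Suc m" for m
  proof -
    have sub: "space M - G m \<subseteq> (\<Union>i<T * Suc m. {\<omega> \<in> space M. 2 \<le> ?d m i \<omega>})"
    proof
      fix \<omega> assume "\<omega> \<in> space M - G m"
      then obtain i where "\<omega> \<in> space M" "i < T * Suc m" "\<not> ?d m i \<omega> \<le> 1" unfolding G_def by blast
      moreover from this have "2 \<le> ?d m i \<omega>" by linarith
      ultimately show "\<omega> \<in> (\<Union>i<T * Suc m. {\<omega> \<in> space M. 2 \<le> ?d m i \<omega>})" by blast
    qed
    have E: "{\<omega> \<in> space M. 2 \<le> ?d m i \<omega>} \<in> sets M" for i by measurable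
    have "prob (space M - (\<Union>m. G m)) \<le> prob (\<Union>i<T * Suc m. {\<omega> \<in> space M. 2 \<le> ?d m i \<omega>})"
    proof (intro finite_measure_mono)
      show "(\<Union>i<T * Suc m. {\<omega> \<in> space M. 2 \<le> ?d m i \<omega>}) \<in> sets M"
        by (rule sets.finite_UN[OF finite_lessThan E])
      show "space M - (\<Union>m. G m) \<subseteq> (\<Union>i<T * Suc m. {\<omega> \<in> space M. 2 \<le> ?d m i \<omega>})"
        by (rule order_trans[OF _ sub]) blast
    qed
    also have "\<dots> \<le> (\<Sum>i<T * Suc m. prob {\<omega> \<in> space M. 2 \<le> ?d m i \<omega>})"
      using E by (intro finite_measure_subadditive_finite image_subsetI finite_lessThan)
    also have "\<dots> \<le> (\<Sum>i<T * Suc m. (lam / Suc m)\<^sup>2)"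
    proof (intro sum_mono)
      fix i
      have "distr M (count_space UNIV) (?d m i) = measure_pmf (poisson_pmf (lam * (real (Suc i) / Suc m - real i / Suc m)))"
        using poisson unfolding poisson_process_def
        by (auto simp: divide_strict_right_mono)
      also have "lam * (real (Suc i) / Suc m - real i / Suc m) = lam / Suc m"
        by (simp add: field_simps)
      finally have D: "distr M (count_space UNIV) (?d m i) = measure_pmf (poisson_pmf (lam / Suc m))" .
      have "prob {\<omega> \<in> space M. 2 \<le> ?d m i \<omega>} = measure (distr M (count_space UNIV) (?d m i)) {2..}"
      proof -
        have "?d m i \<in> measurable M (count_space UNIV)" by measurable
        from measure_distr[OF this, of "{2..}"] show ?thesis
          by (simp only: sets_count_space) (auto intro!: arg_cong[where f = prob])
      qed
      also have "\<dots> \<le> (lam / Suc m)\<^sup>2" unfolding D using lam by (intro poisson_tail_2) auto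
      finally show "prob {\<omega> \<in> space M. 2 \<le> ?d m i \<omega>} \<le> (lam / Suc m)\<^sup>2" .
    qed
    also have "\<dots> = T * lam\<^sup>2 / Suc m"
    proof -
      have "T' * r * (lam / r)\<^sup>2 = T' * lam\<^sup>2 / r" if "r \<noteq> 0" for T' r :: real
        using that by (simp add: power2_eq_square)
      from this[of "real (Suc m)" "real T"] show ?thesis by (simp only: sum_constant card_lessThan of_nat_mult)
    qed
    finally show ?thesis .
  qed
  have "(\<lambda>m. T * lam\<^sup>2 / real (Suc m)) \<longlonglongrightarrow> 0"
    by (rule LIMSEQ_Suc[OF lim_const_over_n])
  then have "prob (space M - (\<Union>m. G m)) \<le> 0"
    using bound by (intro LIMSEQ_le_const) auto
  then have null: "emeasure M (space M - (\<Union>m. G m)) = 0"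
    by (simp add: emeasure_eq_measure measure_le_0_iff)
  show ?thesis
  proof (rule AE_I[OF _ null])
    show "{\<omega> \<in> space M. \<not> (\<exists>m. \<forall>i<T * Suc m. ?d m i \<omega> \<le> 1)} \<subseteq> space M - (\<Union>m. G m)"
      unfolding G_def by blast
  qed measurable
qed

text \<open>Along a good mesh reaching an integer horizon beyond \<open>t\<close>,
  \<open>discrete_ivt\<close> finds a point with count \<open>n\<close>. This lets the process see
  every partial sum of the walk, with none skipped by a multiple jump.\<close>

lemma AE_skip_free: "AE \<omega> in M. \<forall>t\<ge>0. \<forall>n\<le>N t \<omega>. \<exists>u\<in>{0..t}. N u \<omega> = n"
proof -
  have "AE \<omega> in M. \<forall>T :: nat. \<exists>m. \<forall>i<T * Suc m. N (real (Suc i) / Suc m) \<omega> - N (real i / Suc m) \<omega> \<le> 1"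
    using AE_mesh by (simp add: AE_all_countable)
  then show ?thesis
    using AE_space
  proof eventually_elim
    case (elim \<omega>)
    show ?case
    proof (intro allI impI)
      fix t :: real and n assume t: "0 \<le> t" and n: "n \<le> N t \<omega>"
      define T where "T = nat \<lceil>t\<rceil>"
      have T: "t \<le> T" unfolding T_def by linarith
      obtain m where m: "\<And>i. i < T * Suc m \<Longrightarrow> N (real (Suc i) / Suc m) \<omega> - N (real i / Suc m) \<omega> \<le> 1"
        using elim(1) by blast
      have "real (T * Suc m) / Suc m = T"
        unfolding of_nat_mult by (rule nonzero_mult_div_cancel_right) simp
      then have "n \<le> N (real (T * Suc m) / Suc m) \<omega>"
        using n N_mono[OF elim(2) t T] by simp
      then obtain i where i: "N (real i / Suc m) \<omega> = n"
        using discrete_ivt[of "T * Suc m" "\<lambda>i. N (real i / Suc m) \<omega>" n] m N_0[OF elim(2)]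
        by (auto simp del: of_nat_Suc)
      show "\<exists>u\<in>{0..t}. N u \<omega> = n"
      proof (cases "real i / Suc m \<le> t")
        case True
        then show ?thesis using i by (intro bexI[of _ "real i / Suc m"]) auto
      next
        case False
        \<comment> \<open>The mesh point lies beyond \<open>t\<close>, so monotonicity squeezes the
          count at \<open>t\<close> to \<open>n\<close>.\<close>
        then have "N t \<omega> = n" using N_mono[OF elim(2) t, of "real i / Suc m"] i n by auto
        then show ?thesis using t by auto
      qed
    qed
  qed
qed

text \<open>The product of the exponential density and the Poisson weight is a multiple of an Erlang
  density. Thus the number of jumps before an independent exponential time is geometric.\<close>

lemma nn_integral_poisson_point:
  assumes "0 < s"
  shows "(\<integral>\<^sup>+t. ennreal (exponential_density s t) * ennreal ((lam * t) ^ n / fact n * exp (- (lam * t))) \<partial>lborel)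
    = ennreal ((1 - lam / (lam + s)) * (lam / (lam + s)) ^ n)"
proof -
  have "(\<integral>\<^sup>+t. ennreal (exponential_density s t) * ennreal ((lam * t) ^ n / fact n * exp (- (lam * t))) \<partial>lborel)
      = (\<integral>\<^sup>+t. ennreal ((1 - lam / (lam + s)) * (lam / (lam + s)) ^ n) * ennreal (erlang_density n (lam + s) t) \<partial>lborel)"
  proof (rule nn_integral_cong)
    fix t
    have "exponential_density s t * ((lam * t) ^ n / fact n * exp (- (lam * t)))
        = (1 - lam / (lam + s)) * (lam / (lam + s)) ^ n * erlang_density n (lam + s) t"
    proof (cases "t < 0")
      case False
      have "1 - lam / (lam + s) = s / (lam + s)" using lam assms by (simp add: field_simps)
      moreover have "exp (- t * s) * exp (- (lam * t)) = exp (- (lam + s) * t)"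
        by (simp add: mult_exp_exp algebra_simps)
      ultimately show ?thesis using False lam assms
        by (simp add: exponential_density_def erlang_density_def power_mult_distrib power_divide)
           (simp add: field_simps)
    qed (simp add: erlang_density_def)
    then show "ennreal (exponential_density s t) * ennreal ((lam * t) ^ n / fact n * exp (- (lam * t)))
      = ennreal ((1 - lam / (lam + s)) * (lam / (lam + s)) ^ n) * ennreal (erlang_density n (lam + s) t)"
      using lam assms by (simp add: ennreal_mult'[symmetric] exponential_density_nonneg)
  qed
  also have "\<dots> = ennreal ((1 - lam / (lam + s)) * (lam / (lam + s)) ^ n)
      * (\<integral>\<^sup>+t. ennreal (erlang_density n (lam + s) t) \<partial>lborel)"
    by (rule nn_integral_cmult) simp
  also have "(\<integral>\<^sup>+t. ennreal (erlang_density n (lam + s) t) \<partial>lborel) = 1"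
    using nn_integral_erlang_ith_moment[of "lam + s" n 0] lam assms by simp
  finally show ?thesis by simp
qed

lemma nn_integral_N_ge:
  assumes s: "0 < s"
  shows "(\<integral>\<^sup>+t. ennreal (exponential_density s t) * emeasure M {\<omega> \<in> space M. n \<le> N t \<omega>} \<partial>lborel)
    = ennreal ((lam / (lam + s)) ^ n)"
proof -
  let ?a = "lam / (lam + s)"
  have "(\<integral>\<^sup>+t. ennreal (exponential_density s t) * emeasure M {\<omega> \<in> space M. n \<le> N t \<omega>} \<partial>lborel)
      = (\<integral>\<^sup>+t. (\<Sum>m. ennreal (exponential_density s t) * ennreal ((lam * t) ^ (n + m) / fact (n + m) * exp (- (lam * t)))) \<partial>lborel)"
  proof (rule nn_integral_cong_AE)
    \<comment> \<open>\<open>N_distr\<close> covers positive times only; time \<open>0\<close> is a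
      null set.\<close>
    have "AE t in lborel. t \<noteq> (0 :: real)" by (rule AE_lborel_singleton)
    then show "AE t in lborel. ennreal (exponential_density s t) * emeasure M {\<omega> \<in> space M. n \<le> N t \<omega>}
        = (\<Sum>m. ennreal (exponential_density s t) * ennreal ((lam * t) ^ (n + m) / fact (n + m) * exp (- (lam * t))))"
    proof eventually_elim
      case (elim t)
      show ?case
      proof (cases "t < 0")
        case False
        then have t: "0 < t" using elim by simp
        have "emeasure M {\<omega> \<in> space M. n \<le> N t \<omega>} = emeasure (distr M (count_space UNIV) (N t)) {n..}"
          using t N_measurable[of t] by (subst emeasure_distr) (auto intro!: arg_cong[where f = "emeasure M"])
        also have "\<dots> = emeasure (poisson_pmf (lam * t)) (\<Union>m. {n + m})"
          unfolding N_distr[OF t] by (auto intro!: arg_cong[where f = "emeasure _"] simp: le_iff_add)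
        also have "\<dots> = (\<Sum>m. emeasure (poisson_pmf (lam * t)) {n + m})"
          by (intro suminf_emeasure[symmetric]) (auto simp: disjoint_family_on_def)
        also have "\<dots> = (\<Sum>m. ennreal ((lam * t) ^ (n + m) / fact (n + m) * exp (- (lam * t))))"
          using t lam by (simp add: emeasure_pmf_single)
        finally show ?thesis by (simp add: ennreal_suminf_cmult)
      qed (simp add: exponential_density_def)
    qed
  qed
  also have "\<dots> = (\<Sum>m. ennreal ((1 - ?a) * ?a ^ (n + m)))"
  proof (subst nn_integral_suminf)
    show "(\<lambda>t. ennreal (exponential_density s t) * ennreal ((lam * t) ^ (n + m) / fact (n + m) * exp (- (lam * t)))) \<in> borel_measurable lborel" for m
      by measurable
  qed (simp only: nn_integral_poisson_point[OF s])
  also have "\<dots> = ennreal (?a ^ n)"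
  proof (rule suminf_ennreal_eq)
    have a: "0 < ?a" "?a < 1" using lam s by auto
    then show "0 \<le> (1 - ?a) * ?a ^ (n + m)" for m by (intro mult_nonneg_nonneg) auto
    have "(\<lambda>m. (1 - ?a) * ?a ^ n * ?a ^ m) sums ((1 - ?a) * ?a ^ n * (1 / (1 - ?a)))"
      using a by (intro sums_mult geometric_sums) (simp only: real_norm_def abs_of_pos)
    moreover have "(1 - ?a) * ?a ^ n * (1 / (1 - ?a)) = ?a ^ n" using s by simp
    ultimately show "(\<lambda>m. (1 - ?a) * ?a ^ (n + m)) sums (?a ^ n)"
      by (simp only: power_add mult.assoc)
  qed
  finally show ?thesis .
qed

end

section \<open>Hitting events of the compound Poisson process\<close>

definition right_constant :: "(real \<Rightarrow> 'b) \<Rightarrow> bool" where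
  "right_constant x \<longleftrightarrow> (\<forall>t\<ge>0. \<exists>e>0. \<forall>u. t \<le> u \<longrightarrow> u < t + e \<longrightarrow> x u = x t)"

text \<open>One event serves three purposes: \<open>K = UNIV\<close> with \<open>C = {..y}\<close>
  for the minimum and \<open>C = {0<..}\<close> for the maximum, and \<open>C = {x..}\<close>,
  \<open>K = {x - T<..}\<close> for an exit above. The hitting time itself is included in the
  condition on \<open>K\<close>.\<close>

definition hits :: "real set \<Rightarrow> real set \<Rightarrow> real \<Rightarrow> (real \<Rightarrow> real) \<Rightarrow> bool" where
  "hits C K t x \<longleftrightarrow> (\<exists>u\<in>{0..t}. x u \<in> C \<and> (\<forall>w\<in>{0..u}. x w \<in> K))"

text \<open>The product \<open>\<sigma>\<close>-algebra only sees countably many coordinates of a path. Looking slightly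
  beyond \<open>t\<close> along the rationals loses nothing for a right-constant path.\<close>

definition rational_hits :: "real set \<Rightarrow> real set \<Rightarrow> real \<Rightarrow> (real \<Rightarrow> real) \<Rightarrow> bool" where
  "rational_hits C K t x \<longleftrightarrow> (\<forall>k :: nat. \<exists>q :: rat. 0 \<le> q \<and> real_of_rat q < t + 1 / Suc k
     \<and> x (real_of_rat q) \<in> C \<and> (\<forall>q'. 0 \<le> q' \<and> q' \<le> q \<longrightarrow> x (real_of_rat q') \<in> K))"

text \<open>Right constancy moves any real time to a slightly later rational one with the same
  value: the hitting time in one direction, the earlier times of the \<open>K\<close> condition in
  the other.\<close>

lemma hits_iff_rational_hits:
  assumes x: "right_constant x" and t: "0 \<le> t"
  shows "hits C K t x \<longleftrightarrow> rational_hits C K t x"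
proof
  assume "hits C K t x"
  then obtain u where u: "0 \<le> u" "u \<le> t" "x u \<in> C" "\<And>w. 0 \<le> w \<Longrightarrow> w \<le> u \<Longrightarrow> x w \<in> K"
    unfolding hits_def by auto
  obtain e where e: "0 < e" "\<And>v. u \<le> v \<Longrightarrow> v < u + e \<Longrightarrow> x v = x u"
    using x u(1) unfolding right_constant_def by blast
  show "rational_hits C K t x"
    unfolding rational_hits_def
  proof
    fix k :: nat
    have "0 < 1 / real (Suc k)" by simp
    then have "u < min (u + e) (t + 1 / Suc k)"
      using e(1) u(2) by linarith
    then obtain q where q: "u < real_of_rat q" "real_of_rat q < min (u + e) (t + 1 / Suc k)"
      using of_rat_dense by blast
    have "0 \<le> real_of_rat q" using q(1) u(1) by linarith
    then have "0 \<le> q" by simp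
    moreover have "x (real_of_rat q') \<in> K" if "0 \<le> q'" "q' \<le> q" for q'
    proof (cases "real_of_rat q' \<le> u")
      case True then show ?thesis using that u(4) by simp
    next
      case False
      have "real_of_rat q' \<le> real_of_rat q" using that by (simp add: of_rat_less_eq)
      then have "x (real_of_rat q') = x u" using False q by (intro e) auto
      then show ?thesis using u by simp
    qed
    moreover have "x (real_of_rat q) = x u" using q by (intro e) auto
    ultimately show "\<exists>q. 0 \<le> q \<and> real_of_rat q < t + 1 / Suc k \<and> x (real_of_rat q) \<in> C
        \<and> (\<forall>q'. 0 \<le> q' \<and> q' \<le> q \<longrightarrow> x (real_of_rat q') \<in> K)"
      using q u by (intro exI[of _ q]) auto
  qed
next
  assume H: "rational_hits C K t x"
  obtain e where e: "0 < e" "\<And>v. t \<le> v \<Longrightarrow> v < t + e \<Longrightarrow> x v = x t"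
    using x t unfolding right_constant_def by blast
  \<comment> \<open>With this \<open>k\<close> the search window past \<open>t\<close> stays inside
    the interval where the path keeps its value at \<open>t\<close>, so a rational hit beyond
    \<open>t\<close> is already a hit at \<open>t\<close>.\<close>
  obtain k where k: "1 / real (Suc k) < e"
    using reals_Archimedean[OF e(1)] by (auto simp: inverse_eq_divide)
  obtain q where q: "0 \<le> q" "real_of_rat q < t + 1 / Suc k" "x (real_of_rat q) \<in> C"
    "\<And>q'. 0 \<le> q' \<Longrightarrow> q' \<le> q \<Longrightarrow> x (real_of_rat q') \<in> K"
    using H unfolding rational_hits_def by blast
  have K: "x w \<in> K" if w: "0 \<le> w" "w \<le> real_of_rat q" for w
  proof (cases "w = real_of_rat q")
    case True then show ?thesis using q by simp
  next
    case False
    obtain d where d: "0 < d" "\<And>v. w \<le> v \<Longrightarrow> v < w + d \<Longrightarrow> x v = x w"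
      using x w(1) unfolding right_constant_def by blast
    have "w < min (w + d) (real_of_rat q)" using d False w by auto
    then obtain q' where q': "w < real_of_rat q'" "real_of_rat q' < min (w + d) (real_of_rat q)"
      using of_rat_dense by blast
    have "0 \<le> real_of_rat q'" using q'(1) w(1) by linarith
    then have "0 \<le> q'" by simp
    moreover have "q' \<le> q" using q'(2) by (simp add: of_rat_less)
    ultimately have "x (real_of_rat q') \<in> K" by (rule q)
    moreover have "x (real_of_rat q') = x w" using q' by (intro d) auto
    ultimately show ?thesis by simp
  qed
  show "hits C K t x"
  proof (cases "real_of_rat q \<le> t")
    case True
    then show ?thesis unfolding hits_def using q K by (intro bexI[of _ "real_of_rat q"]) auto
  next
    case False
    then have "x (real_of_rat q) = x t" using q k by (intro e) auto
    then show ?thesis unfolding hits_def using q K False t by (intro bexI[of _ t]) auto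
  qed
qed

lemma rational_hits_measurable [measurable]:
  assumes [measurable]: "C \<in> sets borel" "K \<in> sets borel"
  shows "Measurable.pred (borel \<Otimes>\<^sub>M PiM {0..} (\<lambda>_. borel)) (\<lambda>z. rational_hits C K (fst z) (snd z))"
proof -
  have X: "(\<lambda>z :: real \<times> (real \<Rightarrow> real). snd z (real_of_rat q)) \<in> borel_measurable (borel \<Otimes>\<^sub>M PiM {0..} (\<lambda>_. borel))"
    if "0 \<le> q" for q
    using that by (intro measurable_compose[OF measurable_snd measurable_component_singleton]) auto
  have "Measurable.pred (borel \<Otimes>\<^sub>M PiM {0..} (\<lambda>_. borel)) (\<lambda>z. 0 \<le> q \<and> real_of_rat q < fst z + 1 / Suc k
     \<and> snd z (real_of_rat q) \<in> C \<and> (\<forall>q'. 0 \<le> q' \<and> q' \<le> q \<longrightarrow> snd z (real_of_rat q') \<in> K))" for q k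
  \<comment> \<open>Only coordinates in \<open>{0..}\<close> are known to be measurable; for
    negative \<open>q\<close> the condition is plainly false.\<close>
  proof (cases "0 \<le> q")
    case True
    note [measurable] = X[OF True]
    have [measurable]: "Measurable.pred (borel \<Otimes>\<^sub>M PiM {0..} (\<lambda>_. borel))
        (\<lambda>z. 0 \<le> q' \<and> q' \<le> q \<longrightarrow> snd z (real_of_rat q') \<in> K)" for q'
    proof (cases "0 \<le> q'")
      case True
      note [measurable] = X[OF True]
      show ?thesis by measurable
    qed simp
    show ?thesis by measurable
  qed simp
  then show ?thesis unfolding rational_hits_def[abs_def] by measurable
qed

text \<open>By right constancy the infimum defining the exit time is attained. A path that leaves
  above hits at that instant, one that leaves below has violated the \<open>K\<close> condition by
  then, and one that never leaves has no hit.\<close>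

lemma exit_time_hits:
  fixes \<xi> :: "real \<Rightarrow> 'a \<Rightarrow> real"
  assumes rc: "right_constant (\<lambda>t. \<xi> t \<omega>)" and 0: "\<xi> 0 \<omega> = 0" and x: "0 < x" "x < T"
  shows "(\<omega> \<notin> exits_above \<xi> x T \<and> (\<forall>t. \<not> hits {x..} {x - T<..} t (\<lambda>t. \<xi> t \<omega>)))
    \<or> (\<omega> \<in> exits_above \<xi> x T \<and> (\<exists>\<tau>>0. exit_time \<xi> x T \<omega> = ereal \<tau>
        \<and> (\<forall>t. hits {x..} {x - T<..} t (\<lambda>t. \<xi> t \<omega>) \<longleftrightarrow> \<tau> \<le> t)))"
proof -
  define E where "E = {t. 0 < t \<and> \<xi> t \<omega> \<notin> {x - T<..<x}}"
  have et: "exit_time \<xi> x T \<omega> = Inf (ereal ` E)" by (simp add: exit_time_def E_def)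
  \<comment> \<open>Time \<open>0\<close> is no hit because the path starts at \<open>0 < x\<close>,
    so each hit is an exit at a positive time.\<close>
  have hitE: "u \<in> E" if "0 \<le> u" "\<xi> u \<omega> \<in> {x..}" for u
    using that 0 x by (cases "u = 0") (auto simp: E_def)
  show ?thesis
  proof (cases "E = {}")
    case True
    then have "exit_time \<xi> x T \<omega> = \<infinity>" using et by (simp add: top_ereal_def)
    moreover have "\<not> hits {x..} {x - T<..} t (\<lambda>t. \<xi> t \<omega>)" for t
      using hitE True unfolding hits_def by (metis atLeastAtMost_iff empty_iff)
    ultimately show ?thesis by (simp add: exits_above_def)
  next
    case False
    define \<tau> where "\<tau> = Inf E"
    have bdd: "bdd_below E" by (rule bdd_belowI[of _ 0]) (auto simp: E_def)
    have et': "exit_time \<xi> x T \<omega> = ereal \<tau>" unfolding et \<tau>_def using ereal_Inf'[OF bdd False] by simp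
    have le: "\<tau> \<le> u" if "u \<in> E" for u unfolding \<tau>_def using that bdd by (rule cInf_lower)
    have \<tau>0: "0 \<le> \<tau>" unfolding \<tau>_def using False by (intro cInf_greatest) (auto simp: E_def)
    obtain e where e: "0 < e" "\<And>v. \<tau> \<le> v \<Longrightarrow> v < \<tau> + e \<Longrightarrow> \<xi> v \<omega> = \<xi> \<tau> \<omega>"
      using rc \<tau>0 unfolding right_constant_def by blast
    \<comment> \<open>An exit within the interval of constancy after the infimum forces the path to
      be outside at the infimum itself.\<close>
    obtain v where v: "v \<in> E" "v < \<tau> + e"
      using cInf_lessD[OF False, of "\<tau> + e"] e(1) by (auto simp: \<tau>_def)
    then have "\<xi> \<tau> \<omega> = \<xi> v \<omega>" using e(2)[of v] le by simp
    then have out: "\<xi> \<tau> \<omega> \<notin> {x - T<..<x}" using v by (auto simp: E_def)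
    then have pos: "0 < \<tau>" using \<tau>0 0 x by (cases "\<tau> = 0") auto
    have before: "\<xi> w \<omega> \<in> {x - T<..<x}" if "0 \<le> w" "w < \<tau>" for w
      using that le[of w] 0 x by (cases "w = 0") (auto simp: E_def)
    show ?thesis
    proof (cases "x \<le> \<xi> \<tau> \<omega>")
      case True
      have "hits {x..} {x - T<..} t (\<lambda>t. \<xi> t \<omega>) \<longleftrightarrow> \<tau> \<le> t" for t
      proof
        assume "\<tau> \<le> t"
        have "\<xi> w \<omega> \<in> {x - T<..}" if "0 \<le> w" "w \<le> \<tau>" for w
          using before[of w] that True x by (cases "w = \<tau>") auto
        then show "hits {x..} {x - T<..} t (\<lambda>t. \<xi> t \<omega>)"
          unfolding hits_def using \<open>\<tau> \<le> t\<close> True \<tau>0 by (intro bexI[of _ \<tau>]) auto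
      qed (use hitE le in \<open>force simp: hits_def\<close>)
      then show ?thesis using True pos et' by (simp add: exits_above_def)
    next
      case nx: False
      have "\<not> hits {x..} {x - T<..} t (\<lambda>t. \<xi> t \<omega>)" for t
      proof
        assume "hits {x..} {x - T<..} t (\<lambda>t. \<xi> t \<omega>)"
        then obtain u where u: "0 \<le> u" "\<xi> u \<omega> \<in> {x..}" "\<And>w. 0 \<le> w \<Longrightarrow> w \<le> u \<Longrightarrow> \<xi> w \<omega> \<in> {x - T<..}"
          unfolding hits_def by auto
        then have "\<xi> \<tau> \<omega> \<in> {x - T<..}" using le[OF hitE[of u]] \<tau>0 by blast
        then show False using out nx by auto
      qed
      then show ?thesis using nx et' by (simp add: exits_above_def)
    qed
  qed
qed

section \<open>Reduction of path events to the embedded walk\<close>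

locale compound_poisson = poisson_counting M N lam + random_walk M X \<mu>
  for M :: "'a measure" and N lam X \<mu> +
  assumes indep_X_N: "indep_elements M
           (PiM {1..} (\<lambda>_. borel)) (\<lambda>\<omega>. \<lambda>k\<in>{1..}. X k \<omega>)
           (PiM {0..} (\<lambda>_. count_space UNIV)) (sample_path N)"
begin

abbreviation "\<xi> \<equiv> compound_process N X"

lemma xi_eq: "\<xi> t \<omega> = partial_sum X (N t \<omega>) \<omega>"
  by (simp add: compound_process_def partial_sum_def)

lemma xi_0: "\<omega> \<in> space M \<Longrightarrow> \<xi> 0 \<omega> = 0"
  by (simp add: xi_eq N_0)

lemma xi_right_constant: "\<omega> \<in> space M \<Longrightarrow> right_constant (\<lambda>t. \<xi> t \<omega>)"
  unfolding right_constant_def xi_eq by (metis N_right_constant)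

lemma xi_measurable: "0 \<le> t \<Longrightarrow> \<xi> t \<in> borel_measurable M"
  unfolding xi_eq[abs_def] by (rule measurable_compose_countable[OF _ N_measurable]) auto

lemma sample_path_measurable [measurable]: "sample_path \<xi> \<in> measurable M (PiM {0..} (\<lambda>_. borel))"
  unfolding sample_path_def[abs_def] by (rule measurable_restrict) (auto intro: xi_measurable)

lemma rational_hits_sample_path:
  "rational_hits C K t (sample_path \<xi> \<omega>) = rational_hits C K t (\<lambda>t. \<xi> t \<omega>)"
  unfolding rational_hits_def sample_path_def by (simp cong: conj_cong)

lemma hits_sample_path:
  "\<omega> \<in> space M \<Longrightarrow> 0 \<le> t \<Longrightarrow> hits C K t (\<lambda>t. \<xi> t \<omega>) \<longleftrightarrow> rational_hits C K t (sample_path \<xi> \<omega>)"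
  by (simp add: rational_hits_sample_path hits_iff_rational_hits xi_right_constant)

lemma hits_random_time_measurable:
  assumes [measurable]: "C \<in> sets borel" "K \<in> sets borel" "\<theta> \<in> borel_measurable M"
  shows "{\<omega> \<in> space M. 0 \<le> \<theta> \<omega> \<and> hits C K (\<theta> \<omega>) (\<lambda>t. \<xi> t \<omega>)} \<in> sets M"
proof -
  have "Measurable.pred M (\<lambda>\<omega>. rational_hits C K (fst (\<theta> \<omega>, sample_path \<xi> \<omega>)) (snd (\<theta> \<omega>, sample_path \<xi> \<omega>)))"
    by (rule measurable_compose[OF _ rational_hits_measurable]) measurable
  then have "{\<omega> \<in> space M. 0 \<le> \<theta> \<omega> \<and> rational_hits C K (\<theta> \<omega>) (sample_path \<xi> \<omega>)} \<in> sets M"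
    by simp
  also have "{\<omega> \<in> space M. 0 \<le> \<theta> \<omega> \<and> rational_hits C K (\<theta> \<omega>) (sample_path \<xi> \<omega>)}
      = {\<omega> \<in> space M. 0 \<le> \<theta> \<omega> \<and> hits C K (\<theta> \<omega>) (\<lambda>t. \<xi> t \<omega>)}"
    using hits_sample_path by blast
  finally show ?thesis .
qed

text \<open>By \<open>AE_skip_free\<close> the path up to \<open>u\<close> visits exactly the
  partial sums with index at most \<open>N u \<omega>\<close>, so conditions on the path become
  conditions on the walk.\<close>

lemma AE_hits_iff:
  "AE \<omega> in M. \<forall>t\<ge>0. hits C K t (\<lambda>t. \<xi> t \<omega>) \<longleftrightarrow>
     (\<exists>n\<le>N t \<omega>. (\<forall>j<n. partial_sum X j \<omega> \<in> K - C) \<and> partial_sum X n \<omega> \<in> C \<inter> K)"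
  using AE_skip_free AE_space
proof eventually_elim
  case (elim \<omega>)
  show ?case
  proof (intro allI impI iffI)
    fix t :: real assume t: "0 \<le> t" and "hits C K t (\<lambda>t. \<xi> t \<omega>)"
    then obtain u where u: "0 \<le> u" "u \<le> t" "partial_sum X (N u \<omega>) \<omega> \<in> C"
      "\<And>w. 0 \<le> w \<Longrightarrow> w \<le> u \<Longrightarrow> partial_sum X (N w \<omega>) \<omega> \<in> K"
      unfolding hits_def xi_eq by auto
    have K: "partial_sum X j \<omega> \<in> K" if "j \<le> N u \<omega>" for j
    proof -
      obtain w where "w \<in> {0..u}" "N w \<omega> = j" using elim(1) u(1) \<open>j \<le> N u \<omega>\<close> by blast
      then show ?thesis using u(4)[of w] by auto
    qed
    \<comment> \<open>The least index is taken so that all earlier sums avoid \<open>C\<close>,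
      which makes the events for different \<open>n\<close> disjoint later.\<close>
    define n where "n = (LEAST n. partial_sum X n \<omega> \<in> C)"
    have n: "partial_sum X n \<omega> \<in> C" "n \<le> N u \<omega>"
      unfolding n_def using u(3) by (auto intro: LeastI Least_le)
    have "partial_sum X j \<omega> \<notin> C" if "j < n" for j
      using that not_less_Least unfolding n_def by blast
    then show "\<exists>n\<le>N t \<omega>. (\<forall>j<n. partial_sum X j \<omega> \<in> K - C) \<and> partial_sum X n \<omega> \<in> C \<inter> K"
      using n K N_mono[OF elim(2) u(1,2)] by (intro exI[of _ n]) auto
  next
    fix t :: real assume t: "0 \<le> t"
      and "\<exists>n\<le>N t \<omega>. (\<forall>j<n. partial_sum X j \<omega> \<in> K - C) \<and> partial_sum X n \<omega> \<in> C \<inter> K"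
    then obtain n where n: "n \<le> N t \<omega>" "\<And>j. j < n \<Longrightarrow> partial_sum X j \<omega> \<in> K" "partial_sum X n \<omega> \<in> C \<inter> K"
      by blast
    obtain u where u: "u \<in> {0..t}" "N u \<omega> = n" using elim(1) t n(1) by blast
    have "partial_sum X (N w \<omega>) \<omega> \<in> K" if "w \<in> {0..u}" for w
      using that N_mono[OF elim(2), of w u] u n by (cases "N w \<omega> = n") auto
    then show "hits C K t (\<lambda>t. \<xi> t \<omega>)"
      unfolding hits_def xi_eq using u n by (intro bexI[of _ u]) auto
  qed
qed

text \<open>The event is split by the index of the first hit. For each index, the condition on the
  sums and the condition that enough jumps have occurred are independent.\<close>

lemma emeasure_hits:
  assumes [measurable]: "C \<in> sets borel" "K \<in> sets borel" and t: "0 \<le> t"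
  shows "emeasure M {\<omega> \<in> space M. hits C K t (\<lambda>t. \<xi> t \<omega>)}
    = (\<Sum>n. emeasure M {\<omega> \<in> space M. n \<le> N t \<omega>} * ennreal (first_hit \<mu> (C \<inter> K) (K - C) n 0))"
proof -
  note [measurable] = N_measurable[OF t]
  let ?W = "\<lambda>n. {\<omega> \<in> space M. (\<forall>j<n. partial_sum X j \<omega> \<in> K - C) \<and> partial_sum X n \<omega> \<in> C \<inter> K}"
  let ?B = "\<lambda>n. {\<omega> \<in> space M. n \<le> N t \<omega>}"
  have [measurable]: "?W n \<in> sets M" "?B n \<in> sets M" for n by measurable
  have "{\<omega> \<in> space M. hits C K t (\<lambda>t. \<xi> t \<omega>)} \<in> sets M"
    using hits_random_time_measurable[of C K "\<lambda>_. t"] t by simp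
  then have "emeasure M {\<omega> \<in> space M. hits C K t (\<lambda>t. \<xi> t \<omega>)} = emeasure M (\<Union>n. ?B n \<inter> ?W n)"
  proof (rule emeasure_eq_AE[rotated])
    show "AE \<omega> in M. \<omega> \<in> {\<omega> \<in> space M. hits C K t (\<lambda>t. \<xi> t \<omega>)} \<longleftrightarrow> \<omega> \<in> (\<Union>n. ?B n \<inter> ?W n)"
      using AE_hits_iff[of C K] by eventually_elim (use t in auto)
  qed auto
  also have "\<dots> = (\<Sum>n. emeasure M (?B n \<inter> ?W n))"
  proof (rule suminf_emeasure[symmetric])
    have disj: "?W m \<inter> ?W n = {}" if "m < n" for m n using that by auto
    then show "disjoint_family (\<lambda>n. ?B n \<inter> ?W n)"
      unfolding disjoint_family_on_def
    proof (intro ballI impI)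
      fix m n :: nat assume "m \<noteq> n"
      then have "?W m \<inter> ?W n = {}" using disj[of m n] disj[of n m] by (cases "m < n") (simp_all add: Int_commute)
      then show "?B m \<inter> ?W m \<inter> (?B n \<inter> ?W n) = {}" by (simp only: Int_ac Int_empty_right Int_empty_left)
    qed
  qed auto
  also have "\<dots> = (\<Sum>n. emeasure M (?B n) * ennreal (first_hit \<mu> (C \<inter> K) (K - C) n 0))"
  proof (intro suminf_cong)
    fix n :: nat
    let ?PX = "PiM {1..} (\<lambda>_. borel :: real measure)" and ?PN = "PiM {0..} (\<lambda>_ :: real. count_space UNIV :: nat measure)"
    let ?S = "{w \<in> space ?PX. (\<forall>j<n. (\<Sum>k=1..j. w k) \<in> K - C) \<and> (\<Sum>k=1..n. w k) \<in> C \<inter> K}"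
    let ?T = "{w \<in> space ?PN. n \<le> w t}"
    have [measurable]: "(\<lambda>w. \<Sum>k=1..j. w k) \<in> borel_measurable ?PX" for j
      by (intro borel_measurable_sum measurable_component_singleton) auto
    have S: "?S \<in> sets ?PX" by measurable
    have [measurable]: "(\<lambda>w. w t) \<in> measurable ?PN (count_space UNIV)"
      using t by (intro measurable_component_singleton) auto
    have T: "?T \<in> sets ?PN" by measurable
    have X: "(\<lambda>k\<in>{1..}. X k \<omega>) \<in> ?S \<longleftrightarrow> \<omega> \<in> ?W n" if "\<omega> \<in> space M" for \<omega>
      using that by (auto simp: space_PiM partial_sum_def)
    have N: "sample_path N \<omega> \<in> ?T \<longleftrightarrow> \<omega> \<in> ?B n" if "\<omega> \<in> space M" for \<omega>
      using that t by (auto simp: space_PiM sample_path_def)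
    have "prob {\<omega> \<in> space M. (\<lambda>k\<in>{1..}. X k \<omega>) \<in> ?S \<and> sample_path N \<omega> \<in> ?T}
        = prob {\<omega> \<in> space M. (\<lambda>k\<in>{1..}. X k \<omega>) \<in> ?S} * prob {\<omega> \<in> space M. sample_path N \<omega> \<in> ?T}"
      by (rule indep_elements_prob[OF indep_X_N S T])
    moreover have "{\<omega> \<in> space M. (\<lambda>k\<in>{1..}. X k \<omega>) \<in> ?S \<and> sample_path N \<omega> \<in> ?T} = ?B n \<inter> ?W n"
      "{\<omega> \<in> space M. (\<lambda>k\<in>{1..}. X k \<omega>) \<in> ?S} = ?W n" "{\<omega> \<in> space M. sample_path N \<omega> \<in> ?T} = ?B n"
      using X N by blast+
    ultimately have "prob (?B n \<inter> ?W n) = prob (?W n) * prob (?B n)" by (simp only:)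
    also have "prob (?W n) = first_hit \<mu> (C \<inter> K) (K - C) n 0"
      by (intro prob_first_hit) auto
    finally show "emeasure M (?B n \<inter> ?W n) = emeasure M (?B n) * ennreal (first_hit \<mu> (C \<inter> K) (K - C) n 0)"
      by (simp add: emeasure_eq_measure ennreal_mult'' mu.first_hit_bounds mult.commute)
  qed
  finally show ?thesis .
qed

text \<open>Exponential averaging turns the probability of at least \<open>n\<close> jumps into the
  \<open>n\<close>-th power of \<open>lam / (lam + s)\<close>, so the series becomes the generating
  function of the walk.\<close>

lemma nn_integral_hits:
  assumes [measurable]: "C \<in> sets borel" "K \<in> sets borel" and s: "0 < s"
  shows "(\<integral>\<^sup>+t. ennreal (exponential_density s t) * emeasure M {\<omega> \<in> space M. hits C K t (\<lambda>t. \<xi> t \<omega>)} \<partial>lborel)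
    = ennreal (\<Sum>n. (lam / (lam + s)) ^ n * first_hit \<mu> (C \<inter> K) (K - C) n 0)"
proof -
  let ?f = "\<lambda>n. first_hit \<mu> (C \<inter> K) (K - C) n 0" and ?B = "\<lambda>n t. {\<omega> \<in> space M. n \<le> N t \<omega>}"
  have f: "0 \<le> ?f n" for n by (rule mu.first_hit_bounds) auto
  have meas [measurable]: "(\<lambda>t. ennreal (exponential_density s t) * emeasure M (?B n t)) \<in> borel_measurable lborel" for n
  proof -
    \<comment> \<open>Measurability in \<open>t\<close> comes from monotonicity. The value
      \<open>0\<close> at negative times is harmless since the density vanishes there.\<close>
    have "mono (\<lambda>t. if t < 0 then 0 else prob (?B n t))"
    proof (rule monoI)
      fix t u :: real assume "t \<le> u"
      then show "(if t < 0 then 0 else prob (?B n t)) \<le> (if u < 0 then 0 else prob (?B n u))"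
        using N_mono[of _ t u] N_measurable[of u]
        by (auto intro!: finite_measure_mono intro: order_trans)
    qed
    then have [measurable]: "(\<lambda>t. if t < 0 then 0 else prob (?B n t)) \<in> borel_measurable borel"
      by (rule borel_measurable_mono)
    have "(\<lambda>t. ennreal (exponential_density s t) * ennreal (if t < 0 then 0 else prob (?B n t))) \<in> borel_measurable lborel"
      by measurable
    also have "(\<lambda>t. ennreal (exponential_density s t) * ennreal (if t < 0 then 0 else prob (?B n t)))
        = (\<lambda>t. ennreal (exponential_density s t) * emeasure M (?B n t))"
      by (auto simp: fun_eq_iff emeasure_eq_measure exponential_density_def)
    finally show ?thesis .
  qed
  have "(\<integral>\<^sup>+t. ennreal (exponential_density s t) * emeasure M {\<omega> \<in> space M. hits C K t (\<lambda>t. \<xi> t \<omega>)} \<partial>lborel)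
      = (\<integral>\<^sup>+t. (\<Sum>n. ennreal (exponential_density s t) * emeasure M (?B n t) * ennreal (?f n)) \<partial>lborel)"
  proof (rule nn_integral_cong)
    fix t :: real
    show "ennreal (exponential_density s t) * emeasure M {\<omega> \<in> space M. hits C K t (\<lambda>t. \<xi> t \<omega>)}
      = (\<Sum>n. ennreal (exponential_density s t) * emeasure M (?B n t) * ennreal (?f n))"
      by (cases "t < 0")
         (simp_all add: emeasure_hits exponential_density_def ennreal_suminf_cmult mult.assoc)
  qed
  also have "\<dots> = (\<Sum>n. \<integral>\<^sup>+t. ennreal (exponential_density s t) * emeasure M (?B n t) * ennreal (?f n) \<partial>lborel)"
    by (intro nn_integral_suminf) measurable
  also have "\<dots> = (\<Sum>n. ennreal ((lam / (lam + s)) ^ n * ?f n))"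
    using f lam s by (subst nn_integral_multc) (simp_all add: nn_integral_N_ge[OF s] ennreal_mult)
  also have "\<dots> = ennreal (\<Sum>n. (lam / (lam + s)) ^ n * ?f n)"
    using f lam s by (intro suminf_ennreal2 mu.summable_first_hit) auto
  finally show ?thesis .
qed

text \<open>The joint law of killing time and path is a product, so the time is integrated out
  against its density.\<close>

lemma emeasure_hits_random_time:
  assumes [measurable]: "C \<in> sets borel" "K \<in> sets borel" and s: "0 < s"
    and \<theta>: "distributed M lborel \<theta> (exponential_density s)"
    and ind: "indep_elements M borel \<theta> (PiM {0..} (\<lambda>_. borel)) (sample_path \<xi>)"
  shows "emeasure M {\<omega> \<in> space M. 0 \<le> \<theta> \<omega> \<and> hits C K (\<theta> \<omega>) (\<lambda>t. \<xi> t \<omega>)}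
    = ennreal (\<Sum>n. (lam / (lam + s)) ^ n * first_hit \<mu> (C \<inter> K) (K - C) n 0)"
proof -
  let ?PP = "PiM {0..} (\<lambda>_ :: real. borel :: real measure)"
  have \<theta>m [measurable]: "\<theta> \<in> borel_measurable M" using ind by (simp add: indep_elements_def)
  interpret A: prob_space "distr M borel \<theta>" by (rule prob_space_distr) measurable
  interpret B: prob_space "distr M ?PP (sample_path \<xi>)" by (rule prob_space_distr) measurable
  define E where "E = {z \<in> space (borel \<Otimes>\<^sub>M ?PP). 0 \<le> fst z \<and> rational_hits C K (fst z) (snd z)}"
  have E [measurable]: "E \<in> sets (borel \<Otimes>\<^sub>M ?PP)" unfolding E_def by measurable
  have sp: "sample_path \<xi> \<omega> \<in> space ?PP" for \<omega> by (auto simp: sample_path_def space_PiM)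
  have "emeasure M {\<omega> \<in> space M. 0 \<le> \<theta> \<omega> \<and> hits C K (\<theta> \<omega>) (\<lambda>t. \<xi> t \<omega>)}
      = emeasure (distr M (borel \<Otimes>\<^sub>M ?PP) (\<lambda>\<omega>. (\<theta> \<omega>, sample_path \<xi> \<omega>))) E"
    using sp by (subst emeasure_distr)
      (auto simp: E_def space_pair_measure hits_sample_path intro!: arg_cong[where f = "emeasure M"])
  also have "\<dots> = emeasure (distr M borel \<theta> \<Otimes>\<^sub>M distr M ?PP (sample_path \<xi>)) E"
    by (simp add: indep_elements_distr_pair[OF ind])
  also have "\<dots> = (\<integral>\<^sup>+t. emeasure (distr M ?PP (sample_path \<xi>)) (Pair t -` E) \<partial>distr M borel \<theta>)"
    by (rule B.emeasure_pair_measure_alt) simp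
  also have "distr M borel \<theta> = density lborel (exponential_density s)"
    using distributed_distr_eq_density[OF \<theta>] by (metis distr_cong sets_lborel)
  also have "(\<integral>\<^sup>+t. emeasure (distr M ?PP (sample_path \<xi>)) (Pair t -` E) \<partial>density lborel (exponential_density s))
      = (\<integral>\<^sup>+t. ennreal (exponential_density s t) * emeasure (distr M ?PP (sample_path \<xi>)) (Pair t -` E) \<partial>lborel)"
    by (rule nn_integral_density) (auto intro!: B.measurable_emeasure_Pair)
  also have "\<dots> = (\<integral>\<^sup>+t. ennreal (exponential_density s t) * emeasure M {\<omega> \<in> space M. hits C K t (\<lambda>t. \<xi> t \<omega>)} \<partial>lborel)"
  proof (rule nn_integral_cong)
    fix t :: real
    show "ennreal (exponential_density s t) * emeasure (distr M ?PP (sample_path \<xi>)) (Pair t -` E)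
      = ennreal (exponential_density s t) * emeasure M {\<omega> \<in> space M. hits C K t (\<lambda>t. \<xi> t \<omega>)}"
    proof (cases "t < 0")
      case False
      have "emeasure (distr M ?PP (sample_path \<xi>)) (Pair t -` E) = emeasure M (sample_path \<xi> -` (Pair t -` E) \<inter> space M)"
        by (intro emeasure_distr sets_Pair1[OF E]) measurable
      also have "sample_path \<xi> -` (Pair t -` E) \<inter> space M = {\<omega> \<in> space M. hits C K t (\<lambda>t. \<xi> t \<omega>)}"
        using False sp by (auto simp: E_def space_pair_measure hits_sample_path)
      finally show ?thesis by simp
    qed (simp add: exponential_density_def)
  qed
  also note nn_integral_hits[OF assms(1,2) s]
  finally show ?thesis .
qed

text \<open>The discount \<open>exp (- s * \<tau>)\<close> is the exponential mass of the times
  after \<open>\<tau>\<close>, which up to a null set are the times \<open>t\<close> by which the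
  hit has occurred. Fubini then leads to \<open>nn_integral_hits\<close>.\<close>

lemma Q_exit_eq:
  assumes s: "0 < s" and x: "0 < x" "x < T"
  shows "Q_exit M \<xi> T s x = (\<Sum>n. (lam / (lam + s)) ^ n * first_hit \<mu> {x..} {x - T<..<x} n 0)"
proof -
  let ?C = "{x..}" and ?K = "{x - T<..}"
  let ?f = "\<lambda>\<omega>. exp (- s * real_of_ereal (exit_time \<xi> x T \<omega>)) * indicator (exits_above \<xi> x T) \<omega>"
  let ?PP = "PiM {0..} (\<lambda>_ :: real. borel :: real measure)"
  define H where "H = {z \<in> space (lborel \<Otimes>\<^sub>M M). 0 \<le> fst z \<and> rational_hits ?C ?K (fst z) (sample_path \<xi> (snd z))}"
  have "Measurable.pred (lborel \<Otimes>\<^sub>M M) (\<lambda>z. rational_hits ?C ?K (fst (fst z, sample_path \<xi> (snd z))) (snd (fst z, sample_path \<xi> (snd z))))"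
    by (rule measurable_compose[OF _ rational_hits_measurable]) measurable
  then have [measurable]: "Measurable.pred (lborel \<Otimes>\<^sub>M M) (\<lambda>z. rational_hits ?C ?K (fst z) (sample_path \<xi> (snd z)))"
    by simp
  have H [measurable]: "H \<in> sets (lborel \<Otimes>\<^sub>M M)" unfolding H_def by measurable
  have H_iff: "(t, \<omega>) \<in> H \<longleftrightarrow> 0 \<le> t \<and> hits ?C ?K t (\<lambda>t. \<xi> t \<omega>)" if "\<omega> \<in> space M" for t \<omega>
    using that by (auto simp: H_def space_pair_measure hits_sample_path)
  have f: "ennreal (?f \<omega>) = (\<integral>\<^sup>+t. ennreal (exponential_density s t) * indicator H (t, \<omega>) \<partial>lborel)"
    if \<omega>: "\<omega> \<in> space M" for \<omega>
    using exit_time_hits[where \<xi> = \<xi> and \<omega> = \<omega>, OF xi_right_constant[OF \<omega>] xi_0[OF \<omega>] x]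
  proof (elim disjE conjE exE)
    assume "\<omega> \<notin> exits_above \<xi> x T" "\<forall>t. \<not> hits ?C ?K t (\<lambda>t. \<xi> t \<omega>)"
    then show ?thesis by (simp add: indicator_def H_iff[OF \<omega>])
  next
    fix \<tau> :: real assume *: "\<omega> \<in> exits_above \<xi> x T" "0 < \<tau>" "exit_time \<xi> x T \<omega> = ereal \<tau>"
      "\<forall>t. hits ?C ?K t (\<lambda>t. \<xi> t \<omega>) \<longleftrightarrow> \<tau> \<le> t"
    have "(\<integral>\<^sup>+t. ennreal (exponential_density s t) * indicator H (t, \<omega>) \<partial>lborel)
        = (\<integral>\<^sup>+t. ennreal (exponential_density s t) * indicator {\<tau><..} t \<partial>lborel)"
    proof (rule nn_integral_cong_AE)
      \<comment> \<open>The hit has occurred for \<open>t \<ge> \<tau>\<close>; dropping the single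
        point \<open>\<tau>\<close> gives the open tail.\<close>
      show "AE t in lborel. ennreal (exponential_density s t) * indicator H (t, \<omega>)
          = ennreal (exponential_density s t) * indicator {\<tau><..} t"
        using AE_lborel_singleton[of \<tau>]
        by eventually_elim (use * in \<open>auto simp: indicator_def H_iff[OF \<omega>]\<close>)
    qed
    also have "\<dots> = ennreal (exp (- s * \<tau>))"
      using emeasure_exponential_gt[OF s, of \<tau>] * by (simp add: emeasure_density)
    finally show ?thesis using * by simp
  qed
  \<comment> \<open>The discount factor inherits measurability from its representation as a section
    integral of the jointly measurable \<open>H\<close>.\<close>
  have "(\<lambda>\<omega>. \<integral>\<^sup>+t. ennreal (exponential_density s t) * indicator H (t, \<omega>) \<partial>lborel) \<in> borel_measurable M"
    by measurable
  then have "(\<lambda>\<omega>. enn2real (\<integral>\<^sup>+t. ennreal (exponential_density s t) * indicator H (t, \<omega>) \<partial>lborel)) \<in> borel_measurable M"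
    by measurable
  moreover have "enn2real (\<integral>\<^sup>+t. ennreal (exponential_density s t) * indicator H (t, \<omega>) \<partial>lborel) = ?f \<omega>"
    if "\<omega> \<in> space M" for \<omega>
    unfolding f[OF that, symmetric] by (rule enn2real_ennreal) simp
  ultimately have fm: "?f \<in> borel_measurable M"
    by (subst (asm) measurable_cong) auto
  interpret pair_sigma_finite lborel M ..
  have "(\<integral>\<^sup>+\<omega>. ennreal (?f \<omega>) \<partial>M)
      = (\<integral>\<^sup>+\<omega>. \<integral>\<^sup>+t. ennreal (exponential_density s t) * indicator H (t, \<omega>) \<partial>lborel \<partial>M)"
    by (intro nn_integral_cong f)
  also have "\<dots> = (\<integral>\<^sup>+t. \<integral>\<^sup>+\<omega>. ennreal (exponential_density s t) * indicator H (t, \<omega>) \<partial>M \<partial>lborel)"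
    by (rule Fubini') measurable
  also have "\<dots> = (\<integral>\<^sup>+t. ennreal (exponential_density s t) * emeasure M {\<omega> \<in> space M. hits ?C ?K t (\<lambda>t. \<xi> t \<omega>)} \<partial>lborel)"
  proof (rule nn_integral_cong)
    fix t :: real
    show "(\<integral>\<^sup>+\<omega>. ennreal (exponential_density s t) * indicator H (t, \<omega>) \<partial>M)
      = ennreal (exponential_density s t) * emeasure M {\<omega> \<in> space M. hits ?C ?K t (\<lambda>t. \<xi> t \<omega>)}"
    proof (cases "t < 0")
      case False
      have m: "{\<omega> \<in> space M. hits ?C ?K t (\<lambda>t. \<xi> t \<omega>)} \<in> sets M"
        using hits_random_time_measurable[of ?C ?K "\<lambda>_. t"] False by simp
      have "(\<integral>\<^sup>+\<omega>. ennreal (exponential_density s t) * indicator H (t, \<omega>) \<partial>M)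
          = (\<integral>\<^sup>+\<omega>. ennreal (exponential_density s t) * indicator {\<omega> \<in> space M. hits ?C ?K t (\<lambda>t. \<xi> t \<omega>)} \<omega> \<partial>M)"
        using False by (intro nn_integral_cong) (auto simp: indicator_def H_iff)
      then show ?thesis using m by (simp add: nn_integral_cmult_indicator)
    qed (simp add: exponential_density_def)
  qed
  also have "\<dots> = ennreal (\<Sum>n. (lam / (lam + s)) ^ n * first_hit \<mu> (?C \<inter> ?K) (?K - ?C) n 0)"
    using s by (intro nn_integral_hits) auto
  also have "?C \<inter> ?K = {x..}" using x by auto
  also have "?K - ?C = {x - T<..<x}" by auto
  finally have nn: "(\<integral>\<^sup>+\<omega>. ennreal (?f \<omega>) \<partial>M) = ennreal (\<Sum>n. (lam / (lam + s)) ^ n * first_hit \<mu> {x..} {x - T<..<x} n 0)" .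
  have "0 \<le> (\<Sum>n. (lam / (lam + s)) ^ n * first_hit \<mu> {x..} {x - T<..<x} n 0)"
    using lam s by (intro suminf_nonneg mu.summable_first_hit mult_nonneg_nonneg mu.first_hit_bounds) auto
  then show ?thesis
    unfolding Q_exit_def using nn fm by (subst integral_eq_nn_integral) auto
qed

end

section \<open>Extrema at the killing time\<close>

text \<open>The jump law is prescribed by left-continuous distribution functions; their right limits
  are the usual ones, which determine the law.\<close>

lemma real_distribution_eqI_lessThan:
  assumes "real_distribution A" "real_distribution B"
    and eq: "\<And>y. measure A {..<y} = measure B {..<y}"
  shows "A = B"
proof (rule cdf_unique[OF assms(1,2)])
  have lim: "(\<lambda>n. measure L {..<y + 1 / Suc n}) \<longlonglongrightarrow> measure L {..y}" if "real_distribution L" for L y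
  proof -
    interpret real_distribution L by fact
    have "(\<lambda>n. measure L {..<y + 1 / Suc n}) \<longlonglongrightarrow> measure L (\<Inter>n. {..<y + 1 / real (Suc n)})"
      by (intro finite_Lim_measure_decseq) (auto simp: decseq_def frac_le intro: less_le_trans)
    moreover have "(\<Inter>n. {..<y + 1 / real (Suc n)}) = {..y}"
    proof (intro equalityI subsetI)
      fix z assume z: "z \<in> (\<Inter>n. {..<y + 1 / real (Suc n)})"
      show "z \<in> {..y}"
      proof (rule ccontr)
        assume "z \<notin> {..y}"
        then obtain n where "inverse (real (Suc n)) < z - y" using reals_Archimedean[of "z - y"] by auto
        moreover have "z < y + 1 / real (Suc n)" using z by blast
        ultimately show False by (simp add: inverse_eq_divide)
      qed
    qed (auto intro: le_less_trans)
    ultimately show ?thesis by simp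
  qed
  show "cdf A = cdf B"
    unfolding cdf_def fun_eq_iff
    using LIMSEQ_unique[OF lim[OF assms(1)]] lim[OF assms(2)] unfolding eq by blast
qed

context compound_poisson
begin

text \<open>Finiteness turns the infimum and supremum of the path into an attained minimum and
  maximum, hence into hitting events.\<close>

lemma finite_path_range:
  assumes "\<omega> \<in> space M" shows "finite ((\<lambda>u. \<xi> u \<omega>) ` {0..t})"
proof (rule finite_subset)
  show "(\<lambda>u. \<xi> u \<omega>) ` {0..t} \<subseteq> (\<lambda>n. partial_sum X n \<omega>) ` {..N t \<omega>}"
    using N_mono[OF assms] by (auto simp: xi_eq)
qed simp

lemma running_inf_le_iff:
  assumes "\<omega> \<in> space M" "0 \<le> t"
  shows "running_inf \<xi> t \<omega> \<le> y \<longleftrightarrow> hits {..y} UNIV t (\<lambda>t. \<xi> t \<omega>)"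
proof -
  have "running_inf \<xi> t \<omega> = Min ((\<lambda>u. \<xi> u \<omega>) ` {0..t})"
    unfolding running_inf_def using assms by (intro cInf_eq_Min finite_path_range) auto
  then show ?thesis
    using assms by (simp add: Min_le_iff[OF finite_path_range] hits_def)
qed

lemma running_sup_eq_0_iff:
  assumes "\<omega> \<in> space M" "0 \<le> t"
  shows "running_sup \<xi> t \<omega> = 0 \<longleftrightarrow> \<not> hits {0<..} UNIV t (\<lambda>t. \<xi> t \<omega>)"
proof -
  have eq: "running_sup \<xi> t \<omega> = Max ((\<lambda>u. \<xi> u \<omega>) ` {0..t})"
    unfolding running_sup_def using assms by (intro cSup_eq_Max finite_path_range) auto
  have "0 \<le> running_sup \<xi> t \<omega>"
    unfolding eq using assms xi_0[OF assms(1)]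
    by (intro Max_ge finite_path_range image_eqI[of _ _ 0]) auto
  then have "running_sup \<xi> t \<omega> = 0 \<longleftrightarrow> running_sup \<xi> t \<omega> \<le> 0" by auto
  also have "\<dots> \<longleftrightarrow> (\<forall>u\<in>{0..t}. \<xi> u \<omega> \<le> 0)"
    unfolding eq using assms by (simp add: Max_le_iff[OF finite_path_range])
  finally show ?thesis by (auto simp: hits_def not_less)
qed

lemma running_inf_measurable:
  assumes [measurable]: "\<theta> \<in> borel_measurable M"
  shows "(\<lambda>\<omega>. running_inf \<xi> (\<theta> \<omega>) \<omega>) \<in> borel_measurable M"
  unfolding borel_measurable_iff_le
proof
  fix y
  \<comment> \<open>At a negative time the infimum runs over the empty set and has the constant
    value \<open>Inf {}\<close>; the case is kept only for measurability.\<close>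
  have [simp]: "running_inf \<xi> t \<omega> = Inf {}" if "t < 0" for t \<omega>
    using that by (simp add: running_inf_def)
  have "{\<omega> \<in> space M. running_inf \<xi> (\<theta> \<omega>) \<omega> \<le> y}
      = {\<omega> \<in> space M. 0 \<le> \<theta> \<omega> \<and> hits {..y} UNIV (\<theta> \<omega>) (\<lambda>t. \<xi> t \<omega>)}
        \<union> {\<omega> \<in> space M. \<theta> \<omega> < 0 \<and> Inf {} \<le> y}"
    using running_inf_le_iff by (auto simp: not_le) (metis not_le \<open>\<And>t \<omega>. t < 0 \<Longrightarrow> running_inf \<xi> t \<omega> = Inf {}\<close>)+
  also have "\<dots> \<in> sets M"
    by (intro sets.Un hits_random_time_measurable) measurable
  finally show "{\<omega> \<in> space M. running_inf \<xi> (\<theta> \<omega>) \<omega> \<le> y} \<in> sets M" .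
qed

lemma AE_exponential_nonneg:
  assumes "distributed M lborel \<theta> (exponential_density s)"
  shows "AE \<omega> in M. 0 \<le> \<theta> \<omega>"
  by (subst distributed_AE2[OF assms]) (auto simp: exponential_density_def)

context
  fixes \<theta> :: "'a \<Rightarrow> real" and s :: real
  assumes s: "0 < s"
    and \<theta>: "distributed M lborel \<theta> (exponential_density s)"
    and ind: "indep_elements M borel \<theta> (PiM {0..} (\<lambda>_. borel)) (sample_path \<xi>)"
begin

lemma killing_time_measurable [measurable]: "\<theta> \<in> borel_measurable M"
  using ind by (simp add: indep_elements_def)

lemma prob_hits_killing_time:
  assumes "C \<in> sets borel"
  shows "prob {\<omega> \<in> space M. 0 \<le> \<theta> \<omega> \<and> hits C UNIV (\<theta> \<omega>) (\<lambda>t. \<xi> t \<omega>)}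
    = (\<Sum>n. (lam / (lam + s)) ^ n * first_hit \<mu> C (- C) n 0)"
proof -
  have "0 \<le> (\<Sum>n. (lam / (lam + s)) ^ n * first_hit \<mu> C (- C) n 0)"
    using lam s assms
    by (intro suminf_nonneg mu.summable_first_hit mult_nonneg_nonneg mu.first_hit_bounds) auto
  then show ?thesis
    using emeasure_hits_random_time[OF assms _ s \<theta> ind, of UNIV]
    by (simp add: emeasure_eq_measure Compl_eq_Diff_UNIV)
qed

lemma P_minus_distribution: "real_distribution (P_minus M \<xi> \<theta>)"
  unfolding P_minus_def by (intro real_distribution_distr running_inf_measurable) measurable

lemma measure_P_minus:
  "measure (P_minus M \<xi> \<theta>) {..y} = prob {\<omega> \<in> space M. 0 \<le> \<theta> \<omega> \<and> hits {..y} UNIV (\<theta> \<omega>) (\<lambda>t. \<xi> t \<omega>)}"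
proof -
  note [measurable] = running_inf_measurable[OF killing_time_measurable]
  have "measure (P_minus M \<xi> \<theta>) {..y} = prob {\<omega> \<in> space M. running_inf \<xi> (\<theta> \<omega>) \<omega> \<le> y}"
    unfolding P_minus_def by (subst measure_distr) (auto intro!: arg_cong[where f = prob])
  also have "\<dots> = prob {\<omega> \<in> space M. 0 \<le> \<theta> \<omega> \<and> hits {..y} UNIV (\<theta> \<omega>) (\<lambda>t. \<xi> t \<omega>)}"
  proof (rule finite_measure_eq_AE)
    show "AE \<omega> in M. \<omega> \<in> {\<omega> \<in> space M. running_inf \<xi> (\<theta> \<omega>) \<omega> \<le> y}
        \<longleftrightarrow> \<omega> \<in> {\<omega> \<in> space M. 0 \<le> \<theta> \<omega> \<and> hits {..y} UNIV (\<theta> \<omega>) (\<lambda>t. \<xi> t \<omega>)}"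
      using AE_exponential_nonneg[OF \<theta>] by eventually_elim (auto simp: running_inf_le_iff)
    show "{\<omega> \<in> space M. 0 \<le> \<theta> \<omega> \<and> hits {..y} UNIV (\<theta> \<omega>) (\<lambda>t. \<xi> t \<omega>)} \<in> sets M"
      by (rule hits_random_time_measurable) measurable
  qed measurable
  finally show ?thesis .
qed

lemma measure_P_minus_nonpos: "measure (P_minus M \<xi> \<theta>) {..0} = 1"
proof -
  have "AE \<omega> in M. \<omega> \<in> {\<omega> \<in> space M. 0 \<le> \<theta> \<omega> \<and> hits {..0} UNIV (\<theta> \<omega>) (\<lambda>t. \<xi> t \<omega>)}"
    using AE_exponential_nonneg[OF \<theta>] AE_space
  proof eventually_elim
    case (elim \<omega>)
    then have "hits {..0} UNIV (\<theta> \<omega>) (\<lambda>t. \<xi> t \<omega>)"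
      unfolding hits_def by (intro bexI[of _ 0]) (auto simp: xi_0)
    then show ?case using elim by simp
  qed
  then show ?thesis
    unfolding measure_P_minus
    by (subst prob_eq_1) (auto intro!: hits_random_time_measurable)
qed

lemma p_plus_eq:
  "p_plus M \<xi> \<theta> = 1 - (\<Sum>n. (lam / (lam + s)) ^ n * first_hit \<mu> {0<..} (- {0<..}) n 0)"
proof -
  let ?H = "{\<omega> \<in> space M. 0 \<le> \<theta> \<omega> \<and> hits {0<..} UNIV (\<theta> \<omega>) (\<lambda>t. \<xi> t \<omega>)}"
  have H: "?H \<in> sets M" by (rule hits_random_time_measurable) measurable
  \<comment> \<open>As for the infimum: negative times give the constant \<open>Sup {}\<close> and
    form a null set.\<close>
  have [simp]: "running_sup \<xi> t \<omega> = Sup {}" if "t < 0" for t \<omega>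
    using that by (simp add: running_sup_def)
  have "{\<omega> \<in> space M. running_sup \<xi> (\<theta> \<omega>) \<omega> = 0}
      = ({\<omega> \<in> space M. 0 \<le> \<theta> \<omega>} - ?H) \<union> {\<omega> \<in> space M. \<theta> \<omega> < 0 \<and> Sup {} = (0 :: real)}"
  proof (intro set_eqI)
    fix \<omega>
    show "\<omega> \<in> {\<omega> \<in> space M. running_sup \<xi> (\<theta> \<omega>) \<omega> = 0} \<longleftrightarrow>
      \<omega> \<in> ({\<omega> \<in> space M. 0 \<le> \<theta> \<omega>} - ?H) \<union> {\<omega> \<in> space M. \<theta> \<omega> < 0 \<and> Sup {} = (0 :: real)}"
      by (cases "\<theta> \<omega> < 0") (auto simp: running_sup_eq_0_iff)
  qed
  also have "\<dots> \<in> sets M" using H by measurable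
  finally have S: "{\<omega> \<in> space M. running_sup \<xi> (\<theta> \<omega>) \<omega> = 0} \<in> sets M" .
  have "p_plus M \<xi> \<theta> = prob (space M - ?H)"
    unfolding p_plus_def
  proof (rule finite_measure_eq_AE)
    show "AE \<omega> in M. \<omega> \<in> {\<omega> \<in> space M. running_sup \<xi> (\<theta> \<omega>) \<omega> = 0} \<longleftrightarrow> \<omega> \<in> space M - ?H"
      using AE_exponential_nonneg[OF \<theta>] by eventually_elim (auto simp: running_sup_eq_0_iff)
  qed (use S H in auto)
  then show ?thesis using prob_compl[OF H] prob_hits_killing_time[of "{0<..}"] by simp
qed

end

end

section \<open>The two-sided exit formula for the process\<close>

theorem theorem1:
  fixes M :: "'a measure"
    and N :: "real \<Rightarrow> 'a \<Rightarrow> nat"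
    and X :: "nat \<Rightarrow> 'a \<Rightarrow> real"
    and \<xi> :: "real \<Rightarrow> 'a \<Rightarrow> real"
    and \<theta> :: "'a \<Rightarrow> real"
    and F :: "real \<Rightarrow> real"
    and lam c p q s T x :: real
  assumes "prob_space M"
    and "lam > 0" and "c > 0" and "p > 0" and "q > 0" and "p + q = 1"
    and "negative_cdf F"
    and "poisson_process M lam N"
    and "prob_space.indep_vars M (\<lambda>_. borel) X {1..}"
    and "\<And>k y. k \<ge> 1 \<Longrightarrow>
           \<P>(\<omega> in M. X k \<omega> < y)
             = q * F y * indicator {..0} y + (1 - p * exp (- c * y)) * indicator {0<..} y"
    and "indep_elements M
           (PiM {1..} (\<lambda>_. borel)) (\<lambda>\<omega>. \<lambda>k\<in>{1..}. X k \<omega>)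
           (PiM {0..} (\<lambda>_. count_space UNIV)) (sample_path N)"
    and "\<xi> = compound_process N X"
    and "s > 0"
    and "distributed M lborel \<theta> (exponential_density s)"
    and "indep_elements M borel \<theta> (PiM {0..} (\<lambda>_. borel)) (sample_path \<xi>)"
    and "T > 0" and "0 < x" and "x < T"
  shows "Q_exit M \<xi> T s x =
    q_plus M \<xi> \<theta> * exp (- rho_plus M c \<xi> \<theta> * x)
      * (LINT y:{x - T<..0}|P_minus M \<xi> \<theta>. exp (rho_plus M c \<xi> \<theta> * y))
      * inverse (exp (- rho_plus M c \<xi> \<theta> * T)
                   * (LINT y:{..- T}|P_minus M \<xi> \<theta>. exp (c * (T + y)))
                 + (LINT y:{- T<..0}|P_minus M \<xi> \<theta>. exp (rho_plus M c \<xi> \<theta> * y)))"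
proof -
  interpret prob_space M by fact
  define \<mu> where "\<mu> = distr M borel (X 1)"
  have X: "X k \<in> borel_measurable M" if "1 \<le> k" for k
    using assms(9) that by (auto simp: indep_vars_def)
  have lt: "measure (distr M borel (X k)) {..<y}
      = q * F y * indicator {..0} y + (1 - p * exp (- c * y)) * indicator {0<..} y" if "1 \<le> k" for k y
    using X[OF that] assms(10)[OF that, of y]
    by (subst measure_distr) (auto simp: vimage_def Int_def conj_commute)
  have law: "distr M borel (X k) = \<mu>" if "1 \<le> k" for k
    unfolding \<mu>_def using that X
    by (intro real_distribution_eqI_lessThan real_distribution_distr) (simp_all add: lt)
  interpret compound_poisson M N lam X \<mu>
    by unfold_locales (use assms law in auto)
  define a where "a = lam / (lam + s)"
  interpret kw: killed_walk \<mu> a p c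
  proof unfold_locales
    fix y :: real assume y: "0 < y"
    have "measure \<mu> {y..} = measure \<mu> (space \<mu> - {..<y})"
      by (intro arg_cong[where f = "measure \<mu>"]) auto
    also have "\<dots> = 1 - measure \<mu> {..<y}" by (rule mu.prob_compl) simp
    finally show "measure \<mu> {y..} = p * exp (- c * y)" using lt[of 1 y] y by (simp add: \<mu>_def)
  qed (use assms in \<open>auto simp: a_def\<close>)
  obtain r where r: "0 < r" "r < c" "a * (\<integral>x. exp (r * x) \<partial>\<mu>) = 1"
    by (rule kw.lundberg_root)
  define V where "V = P_minus M \<xi> \<theta>"
  note \<theta> = assms(13,14) assms(15)[unfolded assms(12)]
  interpret V: real_distribution V
    unfolding V_def assms(12) by (rule P_minus_distribution[OF \<theta>])
  interpret km: killed_walk_minimum \<mu> a p c V r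
  proof unfold_locales
    show "measure V {..y} = (\<Sum>n. a ^ n * first_hit \<mu> {..y} (- {..y}) n 0)" for y
      unfolding V_def assms(12) measure_P_minus[OF \<theta>] a_def by (rule prob_hits_killing_time[OF \<theta>]) simp
    show "measure V {..0} = 1"
      unfolding V_def assms(12) by (rule measure_P_minus_nonpos[OF \<theta>])
  qed (use r in auto)
  \<comment> \<open>This identifies \<open>rho_plus\<close>, defined through \<open>p_plus\<close>,
    with the Lundberg root \<open>r\<close>.\<close>
  have p_plus: "p_plus M \<xi> \<theta> = r / c"
    unfolding assms(12) p_plus_eq[OF \<theta>] a_def[symmetric] kw.first_hit_positive[OF r] by simp
  have rho: "rho_plus M c \<xi> \<theta> = r" and q_plus: "q_plus M \<xi> \<theta> = (c - r) / c"
    using \<open>c > 0\<close> by (simp_all add: rho_plus_def q_plus_def p_plus diff_divide_distrib)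
  have num: "(LINT y:{b<..0}|V. exp (r * y)) = (\<integral>i. indicator {b<..} i * exp (r * min 0 i) \<partial>V)" for b
    unfolding set_lebesgue_integral_def
  proof (rule integral_cong_AE)
    show "AE i in V. indicator {b<..0} i *\<^sub>R exp (r * i) = indicator {b<..} i * exp (r * min 0 i)"
      using km.AE_V_nonpos by eventually_elim (auto simp: min_def split: split_indicator)
  qed auto
  \<comment> \<open>Separating the two branches of the integrand recovers the two integrals of the
    bracket.\<close>
  have "km.exit_normalizer T = (\<integral>i. exp (- r * T) * (indicator {..- T} i * exp (c * (T + i)))
      + indicator {- T<..} i * exp (r * min 0 i) \<partial>V)"
    unfolding km.exit_normalizer_def
    by (intro Bochner_Integration.integral_cong) (auto split: split_indicator)
  also have "\<dots> = exp (- r * T) * (\<integral>i. indicator {..- T} i * exp (c * (T + i)) \<partial>V)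
      + (\<integral>i. indicator {- T<..} i * exp (r * min 0 i) \<partial>V)"
  proof -
    have "integrable V (\<lambda>i. indicator {..- T} i * exp (c * (T + i)))"
      using \<open>c > 0\<close> by (intro V.integrable_bounded[of _ 1]) (auto simp: mult_nonneg_nonpos split: split_indicator)
    moreover have "integrable V (\<lambda>i. indicator {- T<..} i * exp (r * min 0 i))"
      using km.V_exp_bounded by (intro V.integrable_bounded[of _ 1]) (auto split: split_indicator)
    ultimately show ?thesis by simp
  qed
  finally have den: "exp (- r * T) * (LINT y:{..- T}|V. exp (c * (T + y))) + (LINT y:{- T<..0}|V. exp (r * y))
      = km.exit_normalizer T"
    unfolding num by (simp add: set_lebesgue_integral_def)
  have "Q_exit M \<xi> T s x = (c - r) / c * km.exit_profile T x / km.exit_normalizer T"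
    unfolding assms(12) Q_exit_eq[OF \<open>s > 0\<close> \<open>0 < x\<close> \<open>x < T\<close>] a_def[symmetric]
    using assms by (intro km.first_hit_exit)
  also have "km.exit_profile T x = exp (- r * x) * (LINT y:{x - T<..0}|V. exp (r * y))"
    by (simp add: num km.exit_profile_def)
  finally show ?thesis
    unfolding rho q_plus V_def[symmetric] den by (simp add: divide_inverse mult.assoc)
qed

end
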